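(* Let $(g,\Gamma)$ be a complete Gårding-Dirichlet operator on $S(n)$, let $X\subset\mathbb{R}^n$ be open and $f:X\to\mathbb{R}$ a function. If $u,v\in C^2(X)$ are both solutions of $$g(D^2u)=e^f,\qquad D^2u\in\Gamma\quad\text{on }X,$$ then the difference $w=u-v$ satisfies a linear equation $$Lw\equiv\langle\mathbf{M},D^2w\rangle=0\quad\text{on }X,$$ where $\mathbf{M}:X\to S(n)$ is a continuous, positive-definite matrix-valued function.
   Context: $S(n)$ is the space of real symmetric $n\times n$ matrices with inner product $\langle A,B\rangle=\mathrm{tr}(AB)$. A Gårding-Dirichlet polynomial (operator) of degree $N\ge1$ is a homogeneous real polynomial $g$ of degree $N$ on $S(n)$ such that $g(I)>0$, $t\mapsto g(tI+A)$ has all real roots for every $A\in S(n)$, and the Gårding cone $\Gamma$, i.e. the connected component of $\{g\ne0\}$ containing $I$ (an open convex cone), satisfies $\{A\ge0\}\subset\overline\Gamma$. The same definition applies with $\mathbb{R}^n$ replaced by any finite-dimensional inner product space $V$ and $S(n)$ by the space $\mathrm{Sym}^2(V)$ of quadratic forms on $V$. The pair $(g,\Gamma)$ is complete if there is no proper linear subspace $V\subset\mathbb{R}^n$ and Gårding-Dirichlet polynomial $h$ on $\mathrm{Sym}^2(V)$ with $g(A)=h(A|_V)$ for all $A\in S(n)$, where $A|_V$ is the restriction of the quadratic form $A$ to $V$. $D^2u$ denotes the Hessian of $u$. *)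

theory Defs
  imports "HOL-Analysis.Analysis" "HOL-Computational_Algebra.Polynomial"
begin

text \<open>
  A quadratic form on a linear subspace \<open>V\<close> of \<open>\<real>\<^sup>n\<close> is represented, through the inner product,
  by the self-adjoint operator of \<open>V\<close> that induces it, extended by zero to the orthogonal
  complement of \<open>V\<close> (a symmetric matrix vanishes there as soon as its range lies in \<open>V\<close>).
  The lemma \<open>Sym2_represents\<close> shows that this is a faithful encoding. In particular,
  \<open>Sym2 UNIV\<close> is the space \<open>S(n)\<close> of symmetric matrices.
\<close>

definition Sym2 :: "(real ^ 'n) set \<Rightarrow> (real ^ 'n ^ 'n) set" where
  "Sym2 V = {A. transpose A = A \<and> range (\<lambda>x. A *v x) \<subseteq> V}"

lemma Sym2_UNIV: "Sym2 UNIV = {A. transpose A = A}"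
  by (simp add: Sym2_def)

lemma Sym2_inner:
  assumes "A \<in> Sym2 V"
  shows "x \<bullet> (A *v y) = (A *v x) \<bullet> y"
proof -
  have "transpose A = A" using assms by (simp add: Sym2_def)
  then show ?thesis
    by (metis dot_lmul_matrix transpose_matrix_vector)
qed

lemma Sym2_form_inject:
  assumes V: "subspace V" and A: "A \<in> Sym2 V" and B: "B \<in> Sym2 V"
    and eq: "\<And>x. x \<in> V \<Longrightarrow> x \<bullet> (A *v x) = x \<bullet> (B *v x)"
  shows "A = B"
proof -
  have polar: "x \<bullet> (A *v y) = x \<bullet> (B *v y)" if "x \<in> V" "y \<in> V" for x y
  proof -
    have "x + y \<in> V" using V that by (rule subspace_add)
    from eq[OF this] eq[OF that(1)] eq[OF that(2)]
    have "x \<bullet> (A *v y) + y \<bullet> (A *v x) = x \<bullet> (B *v y) + y \<bullet> (B *v x)"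
      by (simp add: matrix_vector_right_distrib inner_add_left inner_add_right)
    moreover have "y \<bullet> (A *v x) = x \<bullet> (A *v y)" "y \<bullet> (B *v x) = x \<bullet> (B *v y)"
      using Sym2_inner[OF A] Sym2_inner[OF B] by (simp_all add: inner_commute)
    ultimately show ?thesis by simp
  qed
  have rA: "A *v z \<in> V" and rB: "B *v z \<in> V" for z
    using A B by (auto simp: Sym2_def)
  have eqV: "A *v y = B *v y" if "y \<in> V" for y
  proof -
    let ?d = "A *v y - B *v y"
    have "?d \<in> V" using V rA rB by (simp add: subspace_diff)
    from polar[OF this that] have "?d \<bullet> ?d = 0" by (simp add: inner_diff_right)
    then show ?thesis by simp
  qed
  have "A *v y = B *v y" for y
  proof -
    let ?d = "A *v y - B *v y"
    have dV: "?d \<in> V" using V rA rB by (simp add: subspace_diff)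
    have "?d \<bullet> ?d = ?d \<bullet> (A *v y) - ?d \<bullet> (B *v y)" by (simp only: inner_diff_right)
    also have "\<dots> = (A *v ?d) \<bullet> y - (B *v ?d) \<bullet> y"
      using Sym2_inner[OF A] Sym2_inner[OF B] by simp
    also have "\<dots> = 0" using eqV[OF dV] by simp
    finally show ?thesis by simp
  qed
  then show ?thesis by (simp add: matrix_eq)
qed

lemma Sym2_represents:
  fixes V :: "(real ^ 'n) set" and b :: "real ^ 'n \<Rightarrow> real ^ 'n \<Rightarrow> real"
  assumes V: "subspace V" and b: "bilinear b"
  shows "\<exists>!B. B \<in> Sym2 V \<and> (\<forall>x\<in>V. x \<bullet> (B *v x) = b x x)"
proof (rule ex_ex1I)
  obtain C where C: "C \<subseteq> V" "pairwise orthogonal C" "\<And>x. x \<in> C \<Longrightarrow> norm x = 1"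
      "independent C" "card C = dim V" "span C = V"
    using orthonormal_basis_subspace[OF V] by metis
  have fin: "finite C" using C(4) by (rule independent_imp_finite)
  define P where "P x = (\<Sum>c\<in>C. (c \<bullet> x) *\<^sub>R c)" for x :: "real ^ 'n"
  define T where "T y = (\<Sum>c\<in>C. ((b c (P y) + b (P y) c) / 2) *\<^sub>R c)" for y
  have linb: "linear (b x)" "linear (\<lambda>x. b x y)" for x y
    using b by (auto simp: bilinear_def)
  have linP: "linear P"
    unfolding P_def
    by (intro linear_compose_sum ballI linearI) (auto simp: inner_add_right scaleR_add_left)
  have Padd: "P (x + y) = P x + P y" and Pscale: "P (r *\<^sub>R x) = r *\<^sub>R P x" for x y r
    using linP by (simp_all add: linear_add linear_scale)
  have linT: "linear T"
    unfolding T_def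
    by (intro linear_compose_sum ballI linearI)
      (auto simp: Padd Pscale linear_add[OF linb(1)] linear_add[OF linb(2)] linear_scale[OF linb(1)]
        linear_scale[OF linb(2)] algebra_simps add_divide_distrib)
  have inner_T: "x \<bullet> T y = (b (P x) (P y) + b (P y) (P x)) / 2" for x y
  proof -
    have *: "b (P x) z = (\<Sum>c\<in>C. (c \<bullet> x) * b c z)" "b z (P x) = (\<Sum>c\<in>C. (c \<bullet> x) * b z c)" for z
      by (simp_all add: P_def linear_sum[OF linb(1)] linear_sum[OF linb(2)]
          linear_scale[OF linb(1)] linear_scale[OF linb(2)])
    show ?thesis
      unfolding *(1)[of "P y"] *(2)[of "P y"] T_def
      by (simp add: inner_sum_right sum.distrib[symmetric] sum_divide_distrib
          inner_commute[of x] algebra_simps)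
  qed
  have PV: "P x = x" if "x \<in> V" for x
  proof -
    have "P c = c" if "c \<in> C" for c
    proof -
      have "P c = (\<Sum>d\<in>C. if d = c then c else 0)"
        unfolding P_def
      proof (rule sum.cong)
        fix d assume "d \<in> C"
        with that C(2) have "d \<noteq> c \<Longrightarrow> d \<bullet> c = 0"
          by (auto simp: pairwise_def orthogonal_def)
        moreover have "c \<bullet> c = 1" using C(3)[OF that] by (simp add: dot_square_norm)
        ultimately show "(d \<bullet> c) *\<^sub>R d = (if d = c then c else 0)" by auto
      qed simp
      then show ?thesis using fin that by simp
    qed
    then show ?thesis
      using linear_eq_on_span[OF linP linear_id, of C x] that C(6) by simp
  qed
  let ?B = "matrix T"
  have mv: "?B *v x = T x" for x using linT by (simp add: matrix_works)
  have "T y \<in> V" for y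
    unfolding T_def using C(1) by (intro subspace_sum[OF V] subspace_scale[OF V]) auto
  moreover have "transpose ?B = ?B"
  proof -
    have "x \<bullet> (transpose ?B *v y) = x \<bullet> (?B *v y)" for x y
    proof -
      have "x \<bullet> (transpose ?B *v y) = (y v* ?B) \<bullet> x"
        by (simp add: transpose_matrix_vector inner_commute)
      also have "\<dots> = y \<bullet> T x" by (simp add: dot_lmul_matrix mv)
      also have "\<dots> = x \<bullet> T y" by (simp add: inner_T)
      finally show ?thesis by (simp add: mv)
    qed
    then have "transpose ?B *v y = ?B *v y" for y
      using vector_eq_rdot[of "transpose ?B *v y" "?B *v y"] by (simp add: inner_commute)
    then show ?thesis by (simp add: matrix_eq)
  qed
  ultimately have "?B \<in> Sym2 V" by (auto simp: Sym2_def mv)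
  moreover have "\<forall>x\<in>V. x \<bullet> (?B *v x) = b x x" by (simp add: mv inner_T PV)
  ultimately show "\<exists>B. B \<in> Sym2 V \<and> (\<forall>x\<in>V. x \<bullet> (B *v x) = b x x)" by blast
next
  fix A B
  assume "A \<in> Sym2 V \<and> (\<forall>x\<in>V. x \<bullet> (A *v x) = b x x)" "B \<in> Sym2 V \<and> (\<forall>x\<in>V. x \<bullet> (B *v x) = b x x)"
  then show "A = B" using Sym2_form_inject[OF V, of A B] by simp
qed

text \<open>The restriction \<open>A|\<^sub>V\<close> of the quadratic form of \<open>A\<close> to \<open>V\<close>, as an element of \<open>Sym2 V\<close>.\<close>

definition restrict_form :: "(real ^ 'n) set \<Rightarrow> real ^ 'n ^ 'n \<Rightarrow> real ^ 'n ^ 'n" where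
  "restrict_form V A = (THE B. B \<in> Sym2 V \<and> (\<forall>x\<in>V. x \<bullet> (B *v x) = x \<bullet> (A *v x)))"

lemma restrict_form:
  assumes "subspace V"
  shows "restrict_form V A \<in> Sym2 V"
    and "x \<in> V \<Longrightarrow> x \<bullet> (restrict_form V A *v x) = x \<bullet> (A *v x)"
proof -
  have "bilinear (\<lambda>x y. x \<bullet> (A *v y))"
    by (auto simp: bilinear_def intro!: linearI
        simp: inner_add_left inner_add_right matrix_vector_right_distrib
          matrix_vector_mult_scaleR)
  from theI'[OF Sym2_represents[OF assms this]]
  have "restrict_form V A \<in> Sym2 V \<and> (\<forall>x\<in>V. x \<bullet> (restrict_form V A *v x) = x \<bullet> (A *v x))"
    unfolding restrict_form_def .
  then show "restrict_form V A \<in> Sym2 V"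
    and "x \<in> V \<Longrightarrow> x \<bullet> (restrict_form V A *v x) = x \<bullet> (A *v x)" by auto
qed

lemma restrict_form_UNIV: "A \<in> Sym2 UNIV \<Longrightarrow> restrict_form UNIV A = A"
  by (intro Sym2_form_inject[OF subspace_UNIV] restrict_form subspace_UNIV) auto

text \<open>The identity of \<open>Sym2 V\<close>, i.e. the quadratic form \<open>\<lambda>x. x \<bullet> x\<close> on \<open>V\<close>; it is the identity
  matrix for \<open>V = UNIV\<close>.\<close>

definition id_form :: "(real ^ 'n) set \<Rightarrow> real ^ 'n ^ 'n" where
  "id_form V = restrict_form V (mat 1)"

lemma id_form_UNIV: "id_form UNIV = mat 1"
  unfolding id_form_def by (rule restrict_form_UNIV) (simp add: Sym2_UNIV)

definition garding_cone :: "(real ^ 'n) set \<Rightarrow> (real ^ 'n ^ 'n \<Rightarrow> real) \<Rightarrow> (real ^ 'n ^ 'n) set" where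
  "garding_cone V g = connected_component_set {A \<in> Sym2 V. g A \<noteq> 0} (id_form V)"

text \<open>
  Only the values of \<open>g\<close> on \<open>Sym2 V\<close> matter: a polynomial on this linear subspace is the
  restriction of a polynomial on the ambient matrix space. Since \<open>Sym2 V\<close> is closed, the closure
  may be taken in the ambient space.
\<close>

definition garding_dirichlet ::
    "(real ^ 'n) set \<Rightarrow> nat \<Rightarrow> (real ^ 'n ^ 'n \<Rightarrow> real) \<Rightarrow> bool" where
  "garding_dirichlet V N g \<longleftrightarrow>
     N \<ge> 1 \<and>
     (\<exists>p. real_polynomial_function p \<and> (\<forall>A\<in>Sym2 V. g A = p A)) \<and>
     (\<forall>A\<in>Sym2 V. \<forall>t. g (t *\<^sub>R A) = t ^ N * g A) \<and>
     g (id_form V) > 0 \<and>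
     (\<forall>A\<in>Sym2 V. \<exists>q :: real poly.
        (\<forall>t. poly q t = g (t *\<^sub>R id_form V + A)) \<and>
        (\<forall>z :: complex. poly (map_poly complex_of_real q) z = 0 \<longrightarrow> z \<in> \<real>)) \<and>
     {A \<in> Sym2 V. \<forall>x\<in>V. x \<bullet> (A *v x) \<ge> 0} \<subseteq> closure (garding_cone V g)"

definition garding_complete :: "(real ^ 'n ^ 'n \<Rightarrow> real) \<Rightarrow> bool" where
  "garding_complete g \<longleftrightarrow>
     \<not> (\<exists>V M h. subspace V \<and> V \<noteq> UNIV \<and> garding_dirichlet V M h \<and>
          (\<forall>A\<in>Sym2 UNIV. g A = h (restrict_form V A)))"

definition pos_def_matrix :: "real ^ 'n ^ 'n \<Rightarrow> bool" where
  "pos_def_matrix A \<longleftrightarrow> transpose A = A \<and> (\<forall>x. x \<noteq> 0 \<longrightarrow> x \<bullet> (A *v x) > 0)"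

definition grad :: "(real ^ 'n \<Rightarrow> real) \<Rightarrow> real ^ 'n \<Rightarrow> real ^ 'n" where
  "grad u x = (\<chi> i. frechet_derivative u (at x) (axis i 1))"

definition hessian :: "(real ^ 'n \<Rightarrow> real) \<Rightarrow> real ^ 'n \<Rightarrow> real ^ 'n ^ 'n" where
  "hessian u x = jacobian (grad u) (at x)"

text \<open>Meant for open \<open>X\<close>; the continuity of \<open>u\<close> and of its gradient is implied.\<close>

definition C2_on :: "(real ^ 'n) set \<Rightarrow> (real ^ 'n \<Rightarrow> real) \<Rightarrow> bool" where
  "C2_on X u \<longleftrightarrow>
     (\<forall>x\<in>X. u differentiable (at x)) \<and>
     (\<forall>x\<in>X. grad u differentiable (at x)) \<and>
     continuous_on X (hessian u)"

end

theory Submission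
  imports Defs "HOL-Computational_Algebra.Fundamental_Theorem_Algebra"
begin

text \<open>
  The matrix is the averaged gradient \<open>M = \<integral> \<nabla>g (t D\<^sup>2u + (1 - t) D\<^sup>2v) dt\<close> over \<open>0 \<le> t \<le> 1\<close>. It is continuous,
  and the fundamental theorem of calculus on the segment from \<open>D\<^sup>2v\<close> to \<open>D\<^sup>2u\<close> gives
  \<open>\<langle>M, D\<^sup>2u - D\<^sup>2v\<rangle> = g (D\<^sup>2u) - g (D\<^sup>2v) = 0\<close>. What has to be shown is that the segment stays in the Garding cone
  \<open>\<Gamma>\<close>, and that \<open>\<nabla>g\<close> is positive definite there (\<open>averaged_gradient\<close>).

  Both come from Garding's theory of hyperbolic polynomials, developed for a homogeneous real
  polynomial \<open>g\<close> on a Euclidean space. Call \<open>y\<close> hyperbolic if the complexified \<open>g\<close> has no zero \<open>x + \<i> y\<close>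
  with \<open>x\<close> real. Then \<open>|g (x + \<i> y)| \<ge> |g y|\<close> for all \<open>x\<close>, since along \<open>y\<close> all roots are real; this makes
  hyperbolicity a closed condition in \<open>{g \<noteq> 0}\<close> (\<open>hyperbolic_closure\<close>). It is also open: while \<open>r\<close>
  varies, the roots \<open>\<tau>\<close> of \<open>g (\<i> e + r x + \<tau> y)\<close> cannot cross the real axis if \<open>e\<close> is hyperbolic
  (\<open>hyperbolic_if_ray_nonzero\<close>). Hence every point of \<open>\<Gamma>\<close> is hyperbolic (\<open>\<Gamma>_hyperbolic\<close>), and \<open>\<Gamma>\<close> is star-shaped
  about each of its points, that is, convex (\<open>convex_\<Gamma>\<close>).

  For \<open>A \<in> \<Gamma>\<close> and \<open>P\<close> in the closure of \<open>\<Gamma>\<close> it follows that \<open>g (A + t P) = g A \<Prod> (1 + t \<mu>\<^sub>i)\<close> with \<open>\<mu>\<^sub>i \<ge> 0\<close>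
  (\<open>ray_factorization\<close>). So the derivative of \<open>g\<close> at \<open>A\<close> along \<open>P\<close> is nonnegative, and if it vanishes, then \<open>g\<close> is
  constant on the line, \<open>- P\<close> lies in the closure too, and \<open>g\<close> is invariant under
  translation by \<open>P\<close> (\<open>edge_invariant\<close>).

  Take \<open>P = x x\<^sup>T\<close>, which lies in the closure because \<open>g\<close> is a Dirichlet polynomial. If the derivative along
  \<open>P\<close> vanished, positivity of the forms \<open>(y + s x) (y + s x)\<^sup>T\<close> would put all \<open>x y\<^sup>T + y x\<^sup>T\<close> into the edge as well.
  Then \<open>g A\<close> would depend only on the restriction of \<open>A\<close> to the hyperplane orthogonal to \<open>x\<close>
  (\<open>restriction_to_hyperplane\<close>, \<open>garding_dirichlet_hyperplane\<close>), against completeness. So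
  \<open>\<langle>\<nabla>g A, x x\<^sup>T\<rangle> > 0\<close> for all \<open>x \<noteq> 0\<close>, which is positive definiteness.
\<close>

section \<open>Complex polynomials in one variable\<close>

lemma complex_poly_eqI_reals:
  fixes p q :: "complex poly"
  assumes "\<And>t :: real. t > c \<Longrightarrow> poly p (of_real t) = poly q (of_real t)"
  shows "p = q"
proof (rule ccontr)
  assume "p \<noteq> q"
  then have "finite {z. poly (p - q) z = 0}" by (intro poly_roots_finite) simp
  moreover have "complex_of_real ` {c<..} \<subseteq> {z. poly (p - q) z = 0}" using assms by auto
  ultimately have "finite (complex_of_real ` {c<..})" by (rule rev_finite_subset)
  then have "finite {c<..}" by (rule finite_imageD) (simp add: inj_on_def)
  then show False using infinite_Ioi by blast
qed

text \<open>
  A homogeneous polynomial restricted to a complex line is known through its growth along that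
  line; this reads off the degree and the leading coefficient without expanding it.
\<close>

lemma degree_lead_coeff_from_growth:
  fixes q :: "'a :: real_normed_field poly"
  assumes lim: "((\<lambda>z. poly q z / z ^ N) \<longlongrightarrow> c) at_infinity" and c: "c \<noteq> 0"
  shows "degree q = N" and "lead_coeff q = c"
proof -
  have nontriv: "(at_infinity :: 'a filter) \<noteq> bot"
  proof
    assume "(at_infinity :: 'a filter) = bot"
    then obtain b where "\<And>x :: 'a. \<not> b \<le> norm x"
      unfolding trivial_limit_def eventually_at_infinity by blast
    from this[of "of_real \<bar>b\<bar>"] show False by simp
  qed
  let ?d = "degree q"
  have own: "((\<lambda>z. poly q z / z ^ ?d) \<longlongrightarrow> lead_coeff q) at_infinity"
    by (rule poly_divide_tendsto_aux)
  have nz: "\<forall>\<^sub>F z :: 'a in at_infinity. z \<noteq> 0"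
    unfolding eventually_at_infinity by (intro exI[of _ 1]) auto
  have inv: "((\<lambda>z :: 'a. inverse z ^ k) \<longlongrightarrow> 0) at_infinity" if "k > 0" for k
    using tendsto_power[OF tendsto_inverse_0, of k] that by (simp add: power_0_left)
  have "?d = N"
  proof (rule ccontr)
    assume "?d \<noteq> N"
    then consider "?d > N" | "?d < N" by linarith
    then show False
    proof cases
      case 1
      have "((\<lambda>z. poly q z / z ^ N * inverse z ^ (?d - N)) \<longlongrightarrow> c * 0) at_infinity"
        by (intro tendsto_mult lim inv) (use 1 in simp)
      moreover have "\<forall>\<^sub>F z in at_infinity. poly q z / z ^ N * inverse z ^ (?d - N) = poly q z / z ^ ?d"
        using nz by eventually_elim (use 1 in \<open>simp add: field_simps flip: power_add\<close>)
      ultimately have "((\<lambda>z. poly q z / z ^ ?d) \<longlongrightarrow> c * 0) at_infinity"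
        by (rule Lim_transform_eventually)
      then have "lead_coeff q = c * 0" using tendsto_unique[OF nontriv own] by blast
      then have "q = 0" by simp
      then show False using 1 by simp
    next
      case 2
      have "((\<lambda>z. poly q z / z ^ ?d * inverse z ^ (N - ?d)) \<longlongrightarrow> lead_coeff q * 0) at_infinity"
        by (intro tendsto_mult own inv) (use 2 in simp)
      moreover have "\<forall>\<^sub>F z in at_infinity. poly q z / z ^ ?d * inverse z ^ (N - ?d) = poly q z / z ^ N"
        using nz by eventually_elim (use 2 in \<open>simp add: field_simps flip: power_add\<close>)
      ultimately have "((\<lambda>z. poly q z / z ^ N) \<longlongrightarrow> lead_coeff q * 0) at_infinity"
        by (rule Lim_transform_eventually)
      then show False using tendsto_unique[OF nontriv lim] c by fastforce
    qed
  qed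
  then show "degree q = N" "lead_coeff q = c" using tendsto_unique[OF nontriv own] lim by blast+
qed

lemma prod_mset_norm_ge_power:
  fixes A :: "'a :: real_normed_field multiset"
  assumes "\<And>r. r \<in># A \<Longrightarrow> d \<le> norm (z - r)" and "d \<ge> 0"
  shows "d ^ size A \<le> norm (\<Prod>r\<in>#A. z - r)"
  using assms(1)
proof (induction A)
  case (add r A)
  then show ?case using assms(2) by (auto simp: norm_mult intro!: mult_mono)
qed simp

lemma prod_mset_linear_has_derivative:
  fixes M :: "real multiset"
  shows "((\<lambda>t. \<Prod>\<mu>\<in>#M. 1 + t * \<mu>) has_real_derivative sum_mset M) (at 0)"
proof (induction M)
  case (add \<mu> M)
  have "((\<lambda>t. (1 + t * \<mu>) * (\<Prod>\<mu>\<in>#M. 1 + t * \<mu>)) has_real_derivative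
      \<mu> * (\<Prod>\<mu>\<in>#M. 1 + 0 * \<mu>) + sum_mset M * (1 + 0 * \<mu>)) (at 0)"
    by (rule DERIV_mult[OF _ add.IH]) (auto intro!: derivative_eq_intros)
  then show ?case by simp
qed simp

section \<open>Complexification of a homogeneous polynomial\<close>

text \<open>
  A pair \<open>(x, y)\<close> stands for the point \<open>x + \<i> y\<close> of the complexified space, and \<open>cscale\<close> is its
  multiplication by complex scalars.
\<close>

definition cscale :: "complex \<Rightarrow> 'a :: real_vector \<times> 'a \<Rightarrow> 'a \<times> 'a" where
  "cscale z W = (Re z *\<^sub>R fst W - Im z *\<^sub>R snd W, Re z *\<^sub>R snd W + Im z *\<^sub>R fst W)"

lemma cscale_cscale: "cscale z (cscale w W) = cscale (z * w) W"
  by (simp add: cscale_def algebra_simps)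

lemma cscale_add_right: "cscale z (W + Z) = cscale z W + cscale z Z"
  by (simp add: cscale_def algebra_simps)

lemma cscale_of_real [simp]: "cscale (of_real t) W = t *\<^sub>R W"
  by (simp add: cscale_def scaleR_prod_def)

lemma cscale_one [simp]: "cscale 1 W = W" and cscale_zero [simp]: "cscale 0 W = 0"
  by (simp_all add: cscale_def zero_prod_def)

lemma continuous_on_cscale [continuous_intros]:
  fixes f :: "'b :: topological_space \<Rightarrow> 'a :: real_normed_vector \<times> 'a"
  assumes "continuous_on S a" "continuous_on S f"
  shows "continuous_on S (\<lambda>x. cscale (a x) (f x))"
  unfolding cscale_def using assms by (intro continuous_intros)

text \<open>
  Being a polynomial on every complex line is the only form of holomorphy that is used; it turns
  statements about zeros in the complexified space into statements about univariate polynomials.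
\<close>

definition complexifies ::
    "('a :: real_normed_vector \<times> 'a \<Rightarrow> complex) \<Rightarrow> ('a \<Rightarrow> real) \<Rightarrow> bool" where
  "complexifies G g \<longleftrightarrow> continuous_on UNIV G \<and> (\<forall>x. G (x, 0) = of_real (g x)) \<and>
     (\<forall>W Z. \<exists>q. \<forall>z. poly q z = G (W + cscale z Z))"

lemma complexification_exists:
  assumes "real_polynomial_function g"
  shows "\<exists>G. complexifies G g"
  using assms
proof induction
  case (linear f)
  interpret f: bounded_linear f by fact
  let ?G = "\<lambda>W. Complex (f (fst W)) (f (snd W))"
  have "continuous_on UNIV ?G"
    unfolding Complex_eq by (intro continuous_intros f.continuous_on)
  moreover have "\<exists>q. \<forall>z. poly q z = ?G (W + cscale z Z)" for W Z
    by (rule exI[of _ "[:?G W, ?G Z:]"])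
      (auto simp: cscale_def f.add f.diff f.scaleR complex_eq_iff)
  ultimately show ?case
    unfolding complexifies_def by (intro exI[of _ ?G]) (auto simp: complex_eq_iff)
next
  case (const c)
  have "complexifies (\<lambda>W. complex_of_real c) (\<lambda>x :: 'a. c)"
    unfolding complexifies_def by (auto intro!: exI[of _ "[:complex_of_real c:]"])
  then show ?case by blast
next
  case (add f g)
  then obtain F G where FG: "complexifies F f" "complexifies G g" by blast
  have "\<exists>q. \<forall>z. poly q z = F (W + cscale z Z) + G (W + cscale z Z)" for W Z
  proof -
    obtain p q where "\<forall>z. poly p z = F (W + cscale z Z)" "\<forall>z. poly q z = G (W + cscale z Z)"
      using FG unfolding complexifies_def by meson
    then show ?thesis by (intro exI[of _ "p + q"]) simp
  qed
  then have "complexifies (\<lambda>W. F W + G W) (\<lambda>x. f x + g x)"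
    using FG unfolding complexifies_def by (auto intro: continuous_intros)
  then show ?case by blast
next
  case (mult f g)
  then obtain F G where FG: "complexifies F f" "complexifies G g" by blast
  have "\<exists>q. \<forall>z. poly q z = F (W + cscale z Z) * G (W + cscale z Z)" for W Z
  proof -
    obtain p q where "\<forall>z. poly p z = F (W + cscale z Z)" "\<forall>z. poly q z = G (W + cscale z Z)"
      using FG unfolding complexifies_def by meson
    then show ?thesis by (intro exI[of _ "p * q"]) simp
  qed
  then have "complexifies (\<lambda>W. F W * G W) (\<lambda>x. f x * g x)"
    using FG unfolding complexifies_def by (auto intro: continuous_intros)
  then show ?case by blast
qed

locale homogeneous_polynomial =
  fixes g :: "'a :: euclidean_space \<Rightarrow> real" and N :: nat
  assumes polynomial: "real_polynomial_function g"
    and homogeneous: "g (t *\<^sub>R x) = t ^ N * g x"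
begin

definition G :: "'a \<times> 'a \<Rightarrow> complex" where "G = (SOME G. complexifies G g)"

lemma complexifies_G: "complexifies G g"
  unfolding G_def by (rule someI_ex[OF complexification_exists[OF polynomial]])

lemma continuous_G: "continuous_on UNIV G"
  and G_real: "G (x, 0) = of_real (g x)"
  and G_line: "\<exists>q. \<forall>z. poly q z = G (W + cscale z Z)"
  using complexifies_G unfolding complexifies_def by blast+

lemma continuous_on_G [continuous_intros]:
  assumes "continuous_on S f"
  shows "continuous_on S (\<lambda>x. G (f x))"
  using continuous_on_compose2[OF continuous_G assms] by simp

lemma continuous_g: "continuous_on S g"
  using polynomial continuous_polymonial_function[of g]
  by (simp add: real_polynomial_function_eq continuous_at_imp_continuous_on)

lemma G_homogeneous: "G (cscale z W) = z ^ N * G W"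
proof -
  \<comment> \<open>Both steps use that a polynomial in one complex variable is determined by its real values: first
    in the scalar \<open>z\<close> at a real point, then in \<open>w\<close> along the line \<open>x + w y\<close>, which is evaluated at \<open>w = \<i>\<close>.\<close>
  have real_point: "G (cscale z (x, 0)) = z ^ N * of_real (g x)" for x z
  proof -
    obtain q where q: "\<And>z. poly q z = G (0 + cscale z (x, 0))" using G_line by metis
    have "q = monom (of_real (g x)) N"
      by (rule complex_poly_eqI_reals[of 0])
        (simp add: q poly_monom scaleR_prod_def G_real homogeneous mult.commute)
    then show ?thesis using q[of z] by (simp add: poly_monom mult.commute)
  qed
  obtain x y where W: "W = (x, y)" by (cases W)
  obtain p where p: "\<And>w. poly p w = G (cscale z (x, 0) + cscale w (cscale z (y, 0)))"
    using G_line by metis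
  obtain q where q: "\<And>w. poly q w = G ((x, 0) + cscale w (y, 0))" using G_line by metis
  have line: "cscale z (x, 0) + cscale w (cscale z (y, 0)) = cscale z ((x, 0) + cscale w (y, 0))" for w
    by (simp add: cscale_add_right cscale_cscale mult.commute)
  have "p = smult (z ^ N) q"
  proof (rule complex_poly_eqI_reals[of 0])
    fix t :: real
    have "(x, 0) + cscale (of_real t) (y, 0) = (x + t *\<^sub>R y, 0)" by (simp add: scaleR_prod_def)
    then show "poly p (of_real t) = poly (smult (z ^ N) q) (of_real t)"
      unfolding p q poly_smult line by (simp add: real_point G_real)
  qed
  moreover have "(x, 0) + cscale \<i> (y, 0) = W" by (simp add: W cscale_def)
  ultimately show ?thesis using p[of \<i>] q[of \<i>] unfolding line by simp
qed

text \<open>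
  In a real direction \<open>y\<close> with \<open>g y \<noteq> 0\<close> the degree does not drop: by homogeneity \<open>g (W + z y)\<close> grows
  like \<open>z\<^sup>N g y\<close>.
\<close>

lemma line_factorization:
  assumes y: "g y \<noteq> 0"
  shows "\<exists>A. size A = N \<and> (\<forall>z. G (W + cscale z (y, 0)) = of_real (g y) * (\<Prod>r\<in>#A. z - r))"
proof -
  obtain q where q: "\<And>z. poly q z = G (W + cscale z (y, 0))" using G_line by metis
  have "((\<lambda>z. G (cscale (inverse z) W + (y, 0))) \<longlongrightarrow> G (cscale 0 W + (y, 0))) at_infinity"
  proof -
    have "continuous_on UNIV (\<lambda>w. G (cscale w W + (y, 0)))" by (intro continuous_intros)
    then have "isCont (\<lambda>w. G (cscale w W + (y, 0))) 0" by (simp add: continuous_on_eq_continuous_at)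
    from isCont_tendsto_compose[OF this tendsto_inverse_0] show ?thesis .
  qed
  moreover have "\<forall>\<^sub>F z in at_infinity. G (cscale (inverse z) W + (y, 0)) = poly q z / z ^ N"
  proof -
    have "\<forall>\<^sub>F z :: complex in at_infinity. z \<noteq> 0"
      unfolding eventually_at_infinity by (intro exI[of _ 1]) auto
    then show ?thesis
    proof eventually_elim
      case (elim z)
      then have "W + cscale z (y, 0) = cscale z (cscale (inverse z) W + (y, 0))"
        by (simp add: cscale_add_right cscale_cscale)
      then show ?case using elim by (simp add: q G_homogeneous)
    qed
  qed
  ultimately have lim: "((\<lambda>z. poly q z / z ^ N) \<longlongrightarrow> of_real (g y)) at_infinity"
    using tendsto_cong[of "\<lambda>z. G (cscale (inverse z) W + (y, 0))"] by (simp add: G_real)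
  from degree_lead_coeff_from_growth[OF lim] y
  have deg: "degree q = N" and lc: "lead_coeff q = of_real (g y)" by simp_all
  then have "q \<noteq> 0" using y by auto
  from alg_closed_imp_factorization[OF this] obtain A where
    A: "size A = degree q" "q = smult (lead_coeff q) (\<Prod>x\<in>#A. [:-x, 1:])" by metis
  have "poly (\<Prod>x\<in>#A. [:-x, 1:]) z = (\<Prod>r\<in>#A. z - r)" for z
    by (induction A) (auto simp: algebra_simps)
  then have "poly q z = of_real (g y) * (\<Prod>r\<in>#A. z - r)" for z
    by (subst A(2)) (simp add: lc)
  then show ?thesis using A(1) deg q by auto
qed

text \<open>
  A quantitative form of having no zero near \<open>z\<close>. Absence of zeros is in general lost in a limit,
  whereas this bound depends on \<open>W\<close> and \<open>y\<close> only through \<open>g y\<close> and passes to limits. All the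
  closedness arguments below rest on it, and it replaces the continuity of roots.
\<close>

lemma line_norm_ge:
  assumes y: "g y \<noteq> 0" and d: "d \<ge> 0"
    and roots: "\<And>r. G (W + cscale r (y, 0)) = 0 \<Longrightarrow> d \<le> norm (z - r)"
  shows "\<bar>g y\<bar> * d ^ N \<le> norm (G (W + cscale z (y, 0)))"
proof -
  obtain A where A: "size A = N"
      "\<And>z. G (W + cscale z (y, 0)) = of_real (g y) * (\<Prod>r\<in>#A. z - r)"
    using line_factorization[OF y] by metis
  have "G (W + cscale r (y, 0)) = 0" if "r \<in># A" for r
    using that by (auto simp: A(2) image_iff)
  then have "d ^ size A \<le> norm (\<Prod>r\<in>#A. z - r)"
    using roots d by (intro prod_mset_norm_ge_power) auto
  then show ?thesis by (simp add: A norm_mult mult_left_mono)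
qed

end

section \<open>Hyperbolic directions\<close>

text \<open>
  The method of continuity: \<open>U\<close> is the property to be propagated and \<open>C\<close> its reformulation as a
  closed condition.
\<close>

lemma connected_subset_clopen:
  assumes "connected S" "open U" "closed C" "a \<in> S" "a \<in> U"
    and "S \<inter> U \<subseteq> C" "S \<inter> C \<subseteq> U"
  shows "S \<subseteq> U"
proof (rule ccontr)
  assume "\<not> S \<subseteq> U"
  then have "- C \<inter> S \<noteq> {}" using assms(7) by blast
  moreover have "U \<inter> - C \<inter> S = {}" "S \<subseteq> U \<union> - C" "U \<inter> S \<noteq> {}" using assms by blast+
  moreover have "open (- C)" using assms(3) by (rule open_Compl)
  ultimately show False using connectedD[OF assms(1,2)] by blast
qed

context homogeneous_polynomial
begin

text \<open>
  The usual condition, that all the polynomials \<open>t \<mapsto> g (x + t y)\<close> have only real roots, says that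
  \<open>g\<close> has no zero \<open>x + \<i> s y\<close> with \<open>s \<noteq> 0\<close>; by homogeneity it is enough to ask this for \<open>s = 1\<close>. In this
  form hyperbolicity of \<open>y\<close> is a condition on the tube over \<open>y\<close>.
\<close>

definition hyperbolic :: "'a \<Rightarrow> bool" where
  "hyperbolic y \<longleftrightarrow> (\<forall>x. G (x, y) \<noteq> 0)"

lemma hyperbolic_nonzero:
  assumes "hyperbolic y"
  shows "g y \<noteq> 0"
proof
  assume "g y = 0"
  then have "G (cscale \<i> (y, 0)) = 0" by (simp add: G_homogeneous G_real)
  then show False using assms by (simp add: hyperbolic_def cscale_def)
qed

lemma hyperbolic_roots_real:
  assumes y: "hyperbolic y" and root: "G ((x, 0) + cscale z (y, 0)) = 0"
  shows "Im z = 0"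
proof (rule ccontr)
  assume z: "Im z \<noteq> 0"
  have "(x, 0) + cscale z (y, 0)
      = cscale (of_real (Im z)) ((1 / Im z) *\<^sub>R (x + Re z *\<^sub>R y), y)"
    using z by (simp add: cscale_def)
  then show False using root z y by (simp add: G_homogeneous hyperbolic_def flip: cscale_of_real)
qed

lemma hyperbolic_lower_bound:
  assumes y: "hyperbolic y"
  shows "\<bar>g y\<bar> * \<bar>Im z\<bar> ^ N \<le> norm (G ((x, 0) + cscale z (y, 0)))"
proof (rule line_norm_ge[OF hyperbolic_nonzero[OF y]])
  fix r assume "G ((x, 0) + cscale r (y, 0)) = 0"
  from hyperbolic_roots_real[OF y this] show "\<bar>Im z\<bar> \<le> norm (z - r)"
    using abs_Im_le_cmod[of "z - r"] by simp
qed simp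

text \<open>
  Hyperbolicity is closed in \<open>{g \<noteq> 0}\<close>, because \<open>|g (x + \<i> y)| \<ge> |g y|\<close> holds for hyperbolic \<open>y\<close> and hence
  for their limits.
\<close>

lemma hyperbolic_closure:
  assumes y: "y \<in> closure (Collect hyperbolic)" "g y \<noteq> 0"
  shows "hyperbolic y"
  unfolding hyperbolic_def
proof
  fix x
  let ?C = "{y. \<bar>g y\<bar> \<le> norm (G (x, y))}"
  have "closed ?C"
    by (intro closed_Collect_le continuous_intros continuous_g)
  moreover have "Collect hyperbolic \<subseteq> ?C"
    using hyperbolic_lower_bound[of _ \<i> x] by (auto simp: cscale_def)
  ultimately have "y \<in> ?C" using y(1) closure_minimal by blast
  then show "G (x, y) \<noteq> 0" using y(2) by auto
qed

text \<open>
  The roots \<open>\<tau>\<close> of \<open>g (\<i> e + r x + \<tau> y)\<close> stay bounded while \<open>r\<close> does, since \<open>\<tau>\<^sup>N\<close> has the constant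
  coefficient \<open>g y \<noteq> 0\<close>. So a root in the closed upper half plane cannot appear from infinity, and
  compactness yields openness.
\<close>

lemma open_pencil_root_free:
  assumes y: "g y \<noteq> 0"
  shows "open {r :: real. \<forall>\<tau>. Im \<tau> \<ge> 0 \<longrightarrow> G ((r *\<^sub>R x, e) + cscale \<tau> (y, 0)) \<noteq> 0}" (is "open ?U")
proof (subst open_subopen, intro ballI)
  fix r0 assume r0: "r0 \<in> ?U"
  \<comment> \<open>Near infinity, dividing by \<open>\<tau>\<close> and putting \<open>w = 1 / \<tau>\<close> gives \<open>g (w (\<i> e + r x) + y)\<close>, which is
    close to \<open>g y\<close> for small \<open>w\<close>.\<close>
  let ?H = "\<lambda>p :: complex \<times> real. G (cscale (fst p) (snd p *\<^sub>R x, e) + (y, 0))"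
  have "open {p. ?H p \<noteq> 0}" by (intro open_Collect_neq continuous_intros)
  moreover have "(0, r0) \<in> {p. ?H p \<noteq> 0}" using y by (simp add: G_real)
  ultimately obtain d where d: "d > 0" "ball (0, r0) d \<subseteq> {p. ?H p \<noteq> 0}"
    using open_contains_ball by blast
  define K where "K = cball (0 :: complex) (2 / d) \<inter> {\<tau>. Im \<tau> \<ge> 0}"
  have "closed {\<tau>. Im \<tau> \<ge> 0}" by (intro closed_Collect_le continuous_intros)
  then have K: "compact K" unfolding K_def by (intro compact_Int_closed compact_cball)
  let ?Z = "{p. G ((snd p *\<^sub>R x, e) + cscale (fst p) (y, 0)) = 0}"
  have "closed ?Z" by (intro closed_Collect_eq continuous_intros)
  from closed_compact_projection[OF K this]
  have cl: "closed {r. \<exists>\<tau>. \<tau> \<in> K \<and> (\<tau>, r) \<in> ?Z}" .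
  let ?V = "ball r0 (d / 2) \<inter> - {r. \<exists>\<tau>. \<tau> \<in> K \<and> (\<tau>, r) \<in> ?Z}"
  have "open ?V" using cl by (intro open_Int) auto
  moreover have "r0 \<in> ?V" using r0 d(1) by (auto simp: K_def)
  moreover have "?V \<subseteq> ?U"
  proof clarify
    fix r \<tau>
    assume r: "r \<in> ball r0 (d / 2)" and nK: "\<nexists>\<tau>. \<tau> \<in> K \<and> (\<tau>, r) \<in> ?Z"
      and Im: "Im \<tau> \<ge> 0" and root: "G ((r *\<^sub>R x, e) + cscale \<tau> (y, 0)) = 0"
    from nK Im root have "norm \<tau> > 2 / d" unfolding K_def by auto
    moreover have "2 / d > 0" using d(1) by simp
    ultimately have "norm \<tau> > 0" by linarith
    with \<open>norm \<tau> > 2 / d\<close> have "1 / norm \<tau> < d / 2"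
      using d(1) by (simp add: field_simps)
    with \<open>norm \<tau> > 0\<close> have big: "\<tau> \<noteq> 0" "norm (inverse \<tau>) < d / 2"
      by (auto simp: norm_inverse inverse_eq_divide norm_divide)
    have "norm ((inverse \<tau>, r) - (0, r0)) \<le> norm (inverse \<tau>) + norm (r - r0)"
      using norm_Pair_le[of "inverse \<tau>" "r - r0"] by simp
    also have "\<dots> < d" using big(2) r by (simp add: dist_real_def abs_minus_commute)
    finally have "(inverse \<tau>, r) \<in> ball (0, r0) d" 
      unfolding mem_ball dist_norm by (subst norm_minus_commute)
    then have "G (cscale (inverse \<tau>) (r *\<^sub>R x, e) + (y, 0)) \<noteq> 0" using d(2) by force
    moreover have "(r *\<^sub>R x, e) + cscale \<tau> (y, 0) = cscale \<tau> (cscale (inverse \<tau>) (r *\<^sub>R x, e) + (y, 0))"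
      using big(1) by (simp add: cscale_add_right cscale_cscale)
    ultimately show False using root big(1) by (simp add: G_homogeneous)
  qed
  ultimately show "\<exists>T. open T \<and> r0 \<in> T \<and> T \<subseteq> ?U" by blast
qed

text \<open>
  Along the deformation \<open>r\<close> the roots \<open>\<tau>\<close> of \<open>g (\<i> e + r x + \<tau> y)\<close> never meet the real axis, because \<open>e\<close> is
  hyperbolic, and they do not escape to infinity. At \<open>r = 0\<close> they lie in the lower half plane: there
  \<open>\<i> / \<tau>\<close> is a root of \<open>s \<mapsto> g (y + s e)\<close>, hence real, and negative by the assumption on the ray. So
  they lie in the lower half plane for all \<open>r\<close>, and the bound is the closed form of this statement.
\<close>

lemma pencil_lower_bound:
  assumes e: "hyperbolic e" and ray: "\<And>s. s \<ge> 0 \<Longrightarrow> g (y + s *\<^sub>R e) \<noteq> 0"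
    and Im: "Im \<tau> \<ge> 0"
  shows "\<bar>g y\<bar> * Im \<tau> ^ N \<le> norm (G ((r *\<^sub>R x, e) + cscale \<tau> (y, 0)))"
proof -
  define F where "F x r \<tau> = G ((r *\<^sub>R x, e) + cscale \<tau> (y, 0))" for x r \<tau>
  have y: "g y \<noteq> 0" using ray[of 0] by simp
  let ?U = "{r. \<forall>\<tau>. Im \<tau> \<ge> 0 \<longrightarrow> F x r \<tau> \<noteq> 0}"
  let ?C = "{r. \<forall>\<tau>\<in>{\<tau>. Im \<tau> \<ge> 0}. \<bar>g y\<bar> * Im \<tau> ^ N \<le> norm (F x r \<tau>)}"
  have "open ?U" unfolding F_def by (rule open_pencil_root_free[OF y])
  moreover have "closed ?C"
  proof -
    have "?C = (\<Inter>\<tau>\<in>{\<tau>. Im \<tau> \<ge> 0}. {r. \<bar>g y\<bar> * Im \<tau> ^ N \<le> norm (F x r \<tau>)})" by auto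
    then show ?thesis unfolding F_def
      by (auto intro!: closed_INT closed_Collect_le continuous_intros)
  qed
  moreover have "(0 :: real) \<in> ?U"
  proof clarify
    fix \<tau> assume Im: "Im \<tau> \<ge> 0" and root: "F x 0 \<tau> = 0"
    have "\<tau> \<noteq> 0" using root e by (auto simp: F_def hyperbolic_def)
    have "(0, e) + cscale \<tau> (y, 0) = cscale \<tau> ((y, 0) + cscale (\<i> / \<tau>) (e, 0))"
      using \<open>\<tau> \<noteq> 0\<close> by (simp add: cscale_add_right cscale_cscale) (simp add: cscale_def)
    then have root': "G ((y, 0) + cscale (\<i> / \<tau>) (e, 0)) = 0"
      using root \<open>\<tau> \<noteq> 0\<close> by (simp add: F_def G_homogeneous)
    then have "Im (\<i> / \<tau>) = 0" by (rule hyperbolic_roots_real[OF e])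
    then obtain s where s: "\<i> / \<tau> = of_real s" using complex_is_Real_iff Reals_cases by metis
    then have "s \<noteq> 0" using \<open>\<tau> \<noteq> 0\<close> by auto
    then have "\<tau> = \<i> / of_real s" using s \<open>\<tau> \<noteq> 0\<close> by (auto simp: field_simps)
    with Im have "s \<ge> 0" by (simp add: Im_divide_of_real)
    moreover have "g (y + s *\<^sub>R e) = 0" using root' by (simp add: s G_real)
    ultimately show False using ray by blast
  qed
  moreover have "?U \<subseteq> ?C"
  proof clarify
    fix r \<tau>
    assume U: "\<forall>\<tau>. Im \<tau> \<ge> 0 \<longrightarrow> F x r \<tau> \<noteq> 0" and Im: "Im \<tau> \<ge> 0"
    show "\<bar>g y\<bar> * Im \<tau> ^ N \<le> norm (F x r \<tau>)"
      unfolding F_def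
    proof (rule line_norm_ge[OF y Im])
      fix \<rho> assume "G ((r *\<^sub>R x, e) + cscale \<rho> (y, 0)) = 0"
      then have "Im \<rho> < 0" using U by (auto simp: F_def not_le[symmetric])
      then show "Im \<tau> \<le> norm (\<tau> - \<rho>)" using abs_Im_le_cmod[of "\<tau> - \<rho>"] Im by simp
    qed
  qed
  moreover have "?C \<subseteq> ?U"
  proof clarify
    fix r \<tau>
    assume C: "\<forall>\<tau>\<in>{\<tau>. Im \<tau> \<ge> 0}. \<bar>g y\<bar> * Im \<tau> ^ N \<le> norm (F x r \<tau>)"
      and Im: "Im \<tau> \<ge> 0" and root: "F x r \<tau> = 0"
    from C Im root have "\<bar>g y\<bar> * Im \<tau> ^ N \<le> 0" by fastforce
    moreover have "\<bar>g y\<bar> * Im \<tau> ^ N > 0" if "Im \<tau> > 0" using y that by simp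
    ultimately have "Im \<tau> = 0" using Im by fastforce
    then show False using root e by (simp add: F_def cscale_def hyperbolic_def)
  qed
  ultimately have "UNIV \<subseteq> ?U"
    by (intro connected_subset_clopen[OF connected_UNIV, where C = ?C and a = 0]) auto
  with \<open>?U \<subseteq> ?C\<close> have "r \<in> ?C" by blast
  then show ?thesis using Im by (simp add: F_def)
qed

text \<open>
  This is how hyperbolicity spreads from \<open>e\<close> to \<open>y\<close>: rescaling the bound of the pencil at
  \<open>\<tau> = \<i> r\<close> by \<open>r\<close> gives \<open>|g (x + \<i> (y + e / r))| \<ge> |g y|\<close>, and \<open>r\<close> tends to infinity.
\<close>

lemma hyperbolic_if_ray_nonzero:
  assumes e: "hyperbolic e" and ray: "\<And>s. s \<ge> 0 \<Longrightarrow> g (y + s *\<^sub>R e) \<noteq> 0"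
  shows "hyperbolic y"
  unfolding hyperbolic_def
proof
  fix x
  have y: "g y \<noteq> 0" using ray[of 0] by simp
  let ?C = "{s. \<bar>g y\<bar> \<le> norm (G (x, y + s *\<^sub>R e))}"
  have "s \<in> ?C" if "s > 0" for s
  proof -
    have "\<bar>g y\<bar> * (1 / s) ^ N \<le> norm (G (((1 / s) *\<^sub>R x, e) + cscale (\<i> * of_real (1 / s)) (y, 0)))"
      using pencil_lower_bound[OF e ray, of "\<i> * of_real (1 / s)" "1 / s" x] that by simp
    also have "((1 / s) *\<^sub>R x, e) + cscale (\<i> * of_real (1 / s)) (y, 0)
        = cscale (of_real (1 / s)) (x, y + s *\<^sub>R e)"
      using that by (simp add: cscale_def scaleR_add_right)
    also have "norm (G \<dots>) = (1 / s) ^ N * norm (G (x, y + s *\<^sub>R e))"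
      using that by (simp add: G_homogeneous norm_mult norm_power norm_divide del: cscale_of_real)
    finally show ?thesis using that by (simp add: mult.commute)
  qed
  moreover have "closed ?C" by (intro closed_Collect_le continuous_intros)
  ultimately have "closure {0<..} \<subseteq> ?C" by (intro closure_minimal) auto
  moreover have "(0 :: real) \<in> closure {0<..}" by simp
  ultimately have "0 \<in> ?C" by blast
  then show "G (x, y) \<noteq> 0" using y by auto
qed

text \<open>
  Every \<open>y\<close> in a ball around \<open>e\<close> inside \<open>{g \<noteq> 0}\<close> satisfies the condition on the ray, which up to
  positive factors is the segment from \<open>y\<close> to \<open>e\<close>.
\<close>

lemma open_hyperbolic: "open (Collect hyperbolic)"
proof (subst open_subopen, intro ballI)
  fix e assume e: "e \<in> Collect hyperbolic"
  have "open {x. g x \<noteq> 0}" by (intro open_Collect_neq continuous_g continuous_intros)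
  moreover have "e \<in> {x. g x \<noteq> 0}" using e hyperbolic_nonzero by simp
  ultimately obtain d where d: "d > 0" "ball e d \<subseteq> {x. g x \<noteq> 0}"
    using open_contains_ball by blast
  have "ball e d \<subseteq> Collect hyperbolic"
  proof clarify
    fix y assume y: "y \<in> ball e d"
    show "hyperbolic y"
    proof (rule hyperbolic_if_ray_nonzero)
      show "hyperbolic e" using e by simp
      fix s :: real assume s: "s \<ge> 0"
      define z where "z = (1 / (1 + s)) *\<^sub>R y + (s / (1 + s)) *\<^sub>R e"
      have "z \<in> ball e d" unfolding z_def
        using y s d(1) by (intro convexD[OF convex_ball]) (auto simp: field_simps)
      then have "g z \<noteq> 0" using d(2) by blast
      moreover have "y + s *\<^sub>R e = (1 + s) *\<^sub>R z"
        using s by (simp add: z_def scaleR_add_right)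
      ultimately show "g (y + s *\<^sub>R e) \<noteq> 0" using s by (simp add: homogeneous)
    qed
  qed
  then show "\<exists>T. open T \<and> e \<in> T \<and> T \<subseteq> Collect hyperbolic"
    using d(1) by (intro exI[of _ "ball e d"]) auto
qed

end

section \<open>The Garding cone\<close>

lemma prod_mset_of_real:
  "(\<Prod>x\<in>#A. of_real (f x)) = (of_real (\<Prod>x\<in>#A. f x) :: 'b :: {real_algebra_1, comm_semiring_1})"
  by (induction A) simp_all

lemma sum_mset_nonneg_eq_0:
  fixes M :: "real multiset"
  assumes "\<And>\<mu>. \<mu> \<in># M \<Longrightarrow> \<mu> \<ge> 0"
  shows "sum_mset M \<ge> 0" and "sum_mset M = 0 \<Longrightarrow> \<mu> \<in># M \<Longrightarrow> \<mu> = 0"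
proof -
  have "sum_mset M \<ge> 0 \<and> (sum_mset M = 0 \<longrightarrow> (\<forall>\<mu>\<in>#M. \<mu> = 0))"
    using assms
  proof (induction M)
    case (add \<mu> M)
    then have "sum_mset M \<ge> 0" "\<mu> \<ge> 0" "sum_mset M = 0 \<longrightarrow> (\<forall>\<mu>\<in>#M. \<mu> = 0)" by simp_all
    then show ?case by (auto simp: add_nonneg_eq_0_iff)
  qed simp
  then show "sum_mset M \<ge> 0" and "sum_mset M = 0 \<Longrightarrow> \<mu> \<in># M \<Longrightarrow> \<mu> = 0" by blast+
qed

locale hyperbolic_polynomial = homogeneous_polynomial g N
  for g :: "'a :: euclidean_space \<Rightarrow> real" and N +
  fixes e :: 'a
  assumes positive: "g e > 0"
    and real_rooted: "\<exists>q :: real poly. (\<forall>t. poly q t = g (t *\<^sub>R e + x)) \<and>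
      (\<forall>z :: complex. poly (map_poly complex_of_real q) z = 0 \<longrightarrow> z \<in> \<real>)"
begin

lemma hyperbolic_e: "hyperbolic e"
  unfolding hyperbolic_def
proof (intro allI notI)
  fix x assume root: "G (x, e) = 0"
  obtain q where q: "\<And>t. poly q t = g (t *\<^sub>R e + x)"
      "\<And>z :: complex. poly (map_poly complex_of_real q) z = 0 \<Longrightarrow> z \<in> \<real>"
    using real_rooted by metis
  obtain p where p: "\<And>z. poly p z = G ((x, 0) + cscale z (e, 0))" using G_line by metis
  have "map_poly complex_of_real q = p"
  proof (rule complex_poly_eqI_reals[of 0])
    fix t :: real
    have "poly (map_poly complex_of_real q) (of_real t) = of_real (poly q t)"
      by (induction q) (auto simp: map_poly_pCons)
    then show "poly (map_poly complex_of_real q) (of_real t) = poly p (of_real t)"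
      by (simp add: p q(1) G_real add.commute)
  qed
  moreover have "poly p \<i> = 0" using root by (simp add: p cscale_def)
  ultimately have "\<i> \<in> \<real>" using q(2) by blast
  then show False by (simp add: complex_is_Real_iff)
qed

definition \<Gamma> :: "'a set" where
  "\<Gamma> = connected_component_set {x. g x \<noteq> 0} e"

lemma e_in_\<Gamma>: "e \<in> \<Gamma>"
  using positive by (simp add: \<Gamma>_def)

lemma connected_\<Gamma>: "connected \<Gamma>"
  by (simp add: \<Gamma>_def)

lemma \<Gamma>_nonzero: "y \<in> \<Gamma> \<Longrightarrow> g y \<noteq> 0"
  unfolding \<Gamma>_def using connected_component_subset by fastforce

lemma open_\<Gamma>: "open \<Gamma>"
  unfolding \<Gamma>_def by (intro open_connected_component open_Collect_neq continuous_g continuous_intros)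

lemma \<Gamma>_maximal:
  assumes "connected S" "S \<subseteq> {x. g x \<noteq> 0}" "y \<in> S" "y \<in> \<Gamma>"
  shows "S \<subseteq> \<Gamma>"
  using connected_component_maximal[OF assms(3,1,2)] connected_component_eq[of y] assms(4)
  unfolding \<Gamma>_def by metis

lemma \<Gamma>_positive:
  assumes "y \<in> \<Gamma>"
  shows "g y > 0"
proof (rule ccontr)
  assume "\<not> g y > 0"
  have "connected (g ` \<Gamma>)" by (intro connected_continuous_image continuous_g connected_\<Gamma>)
  from connected_contains_Icc[OF this, of "g y" "g e"]
  have "{g y..g e} \<subseteq> g ` \<Gamma>" using assms e_in_\<Gamma> by simp
  moreover have "0 \<in> {g y..g e}" using \<open>\<not> g y > 0\<close> positive by simp
  ultimately show False using \<Gamma>_nonzero by fastforce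
qed

text \<open>
  Garding's theorem on the change of direction, by the method of continuity in \<open>\<Gamma>\<close>.
\<close>

lemma \<Gamma>_hyperbolic:
  assumes "y \<in> \<Gamma>"
  shows "hyperbolic y"
proof -
  have "\<Gamma> \<subseteq> Collect hyperbolic"
  proof (rule connected_subset_clopen[OF connected_\<Gamma> open_hyperbolic _ e_in_\<Gamma>])
    show "\<Gamma> \<inter> closure (Collect hyperbolic) \<subseteq> Collect hyperbolic"
      using hyperbolic_closure \<Gamma>_nonzero by blast
  qed (use closure_subset[of "Collect hyperbolic"] hyperbolic_e in auto)
  then show ?thesis using assms by blast
qed

text \<open>
  The cone is star-shaped about each of its points \<open>y\<close>, which is the substance of convexity. If the
  segment from \<open>w\<close> to \<open>y\<close> avoids the zeros of \<open>g\<close>, the real roots of \<open>r \<mapsto> g (w' + r y)\<close> for \<open>w'\<close> a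
  nonnegative multiple of \<open>w\<close> are not positive; this bounds \<open>g\<close> from below on the segment, and makes
  the avoidance a closed condition on \<open>w\<close>.
\<close>

lemma \<Gamma>_segment_nonzero:
  assumes y: "y \<in> \<Gamma>" and w: "w \<in> \<Gamma>" and s: "s \<in> {0..1}"
  shows "g ((1 - s) *\<^sub>R w + s *\<^sub>R y) \<noteq> 0"
proof -
  let ?C = "{w. \<forall>s\<in>{0..1}. g ((1 - s) *\<^sub>R w + s *\<^sub>R y) \<noteq> 0}"
  let ?D = "{w. \<forall>s\<in>{0..1}. \<bar>g y\<bar> * s ^ N \<le> \<bar>g ((1 - s) *\<^sub>R w + s *\<^sub>R y)\<bar>}"
  note cont = continuous_on_compose2[OF continuous_g[of UNIV]]
  have "closed {p. g ((1 - fst p) *\<^sub>R snd p + fst p *\<^sub>R y) = 0}"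
    by (intro closed_Collect_eq continuous_intros cont) auto
  from closed_compact_projection[OF compact_Icc this, of 0 1]
  have "open (- {w. \<exists>s. s \<in> {0..1} \<and> (s, w) \<in> {p. g ((1 - fst p) *\<^sub>R snd p + fst p *\<^sub>R y) = 0}})"
    by (rule open_Compl)
  also have "- {w. \<exists>s. s \<in> {0..1} \<and> (s, w) \<in> {p. g ((1 - fst p) *\<^sub>R snd p + fst p *\<^sub>R y) = 0}} = ?C"
    by auto
  finally have "open ?C" .
  moreover have "closed ?D"
  proof -
    have "?D = (\<Inter>s\<in>{0..1}. {w. \<bar>g y\<bar> * s ^ N \<le> \<bar>g ((1 - s) *\<^sub>R w + s *\<^sub>R y)\<bar>})" by auto
    also have "closed \<dots>"
      by (intro closed_INT ballI closed_Collect_le continuous_intros cont) auto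
    finally show ?thesis .
  qed
  moreover have "y \<in> ?C"
    using \<Gamma>_nonzero[OF y] by (simp flip: scaleR_add_left)
  moreover have "\<Gamma> \<inter> ?C \<subseteq> ?D"
  proof clarify
    fix w and s :: real
    assume C: "\<forall>s\<in>{0..1}. g ((1 - s) *\<^sub>R w + s *\<^sub>R y) \<noteq> 0" and s: "s \<in> {0..1}"
    have "\<bar>g y\<bar> * s ^ N \<le> norm (G (((1 - s) *\<^sub>R w, 0) + cscale (of_real s) (y, 0)))"
    proof (rule line_norm_ge[OF \<Gamma>_nonzero[OF y]])
      fix r assume root: "G (((1 - s) *\<^sub>R w, 0) + cscale r (y, 0)) = 0"
      then have "Im r = 0" by (rule hyperbolic_roots_real[OF \<Gamma>_hyperbolic[OF y]])
      then have r: "r = of_real (Re r)" by (simp add: complex_eq_iff)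
      have "Re r \<le> 0"
      proof (rule ccontr)
        assume pos: "\<not> Re r \<le> 0"
        define c where "c = 1 - s + Re r"
        have c: "c > 0" using pos s by (simp add: c_def)
        \<comment> \<open>A positive root would, after division by \<open>c\<close>, be a zero on the segment itself.\<close>
        have "(1 - s) *\<^sub>R w + Re r *\<^sub>R y = c *\<^sub>R ((1 - Re r / c) *\<^sub>R w + (Re r / c) *\<^sub>R y)"
          using c by (simp add: scaleR_add_right right_diff_distrib) (simp add: c_def)
        moreover have "g ((1 - s) *\<^sub>R w + Re r *\<^sub>R y) = 0"
          using root by (subst (asm) r) (simp add: G_real)
        ultimately have "g ((1 - Re r / c) *\<^sub>R w + (Re r / c) *\<^sub>R y) = 0"
          using c by (simp add: homogeneous)
        moreover have "Re r / c \<in> {0..1}" using pos c s by (auto simp: c_def field_simps)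
        ultimately show False using C by blast
      qed
      then show "s \<le> norm (of_real s - r)"
        using abs_Re_le_cmod[of "of_real s - r"] by simp
    qed (use s in simp)
    then show "\<bar>g y\<bar> * s ^ N \<le> \<bar>g ((1 - s) *\<^sub>R w + s *\<^sub>R y)\<bar>" by (simp add: G_real)
  qed
  moreover have "\<Gamma> \<inter> ?D \<subseteq> ?C"
  proof clarify
    fix w and s :: real
    assume w: "w \<in> \<Gamma>" and D: "\<forall>s\<in>{0..1}. \<bar>g y\<bar> * s ^ N \<le> \<bar>g ((1 - s) *\<^sub>R w + s *\<^sub>R y)\<bar>"
      and s: "s \<in> {0..1}" and zero: "g ((1 - s) *\<^sub>R w + s *\<^sub>R y) = 0"
    have "\<bar>g y\<bar> * s ^ N \<le> 0" using D s zero by fastforce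
    moreover have "\<bar>g y\<bar> * s ^ N > 0" if "s > 0" using \<Gamma>_nonzero[OF y] that by simp
    ultimately have "s = 0" using s by fastforce
    then show False using zero \<Gamma>_nonzero[OF w] by simp
  qed
  ultimately have "\<Gamma> \<subseteq> ?C" by (intro connected_subset_clopen[OF connected_\<Gamma> _ _ y])
  then show ?thesis using w s by blast
qed

lemma convex_\<Gamma>: "convex \<Gamma>"
  unfolding convex_contains_segment
proof (intro ballI)
  fix w y assume wy: "w \<in> \<Gamma>" "y \<in> \<Gamma>"
  show "closed_segment w y \<subseteq> \<Gamma>"
  proof (rule \<Gamma>_maximal)
    show "closed_segment w y \<subseteq> {x. g x \<noteq> 0}"
      using \<Gamma>_segment_nonzero[OF wy(2,1)] by (auto simp: closed_segment_def)
  qed (use wy in auto)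
qed

lemma \<Gamma>_scale:
  assumes "y \<in> \<Gamma>" "t > 0"
  shows "t *\<^sub>R y \<in> \<Gamma>"
proof -
  have "(\<lambda>c. c *\<^sub>R y) ` {0<..} \<subseteq> \<Gamma>"
  proof (rule \<Gamma>_maximal)
    show "connected ((\<lambda>c. c *\<^sub>R y) ` {0<..})"
      by (intro connected_continuous_image continuous_intros) simp
    show "y \<in> (\<lambda>c. c *\<^sub>R y) ` {0<..}" by (rule image_eqI[of _ _ 1]) auto
  qed (use assms \<Gamma>_nonzero in \<open>auto simp: homogeneous\<close>)
  then show ?thesis using assms by auto
qed

lemma \<Gamma>_add:
  assumes "y \<in> \<Gamma>" "w \<in> \<Gamma>"
  shows "y + w \<in> \<Gamma>"
proof -
  have "(1 / 2) *\<^sub>R y + (1 / 2) *\<^sub>R w \<in> \<Gamma>" using assms by (intro convexD[OF convex_\<Gamma>]) auto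
  from \<Gamma>_scale[OF this, of 2] show ?thesis by (simp add: scaleR_add_right)
qed

lemma \<Gamma>_add_closure:
  assumes "y \<in> \<Gamma>" "p \<in> closure \<Gamma>"
  shows "y + p \<in> \<Gamma>"
proof -
  obtain d where d: "d > 0" "ball y d \<subseteq> \<Gamma>" using open_\<Gamma> assms(1) open_contains_ball by blast
  obtain q where q: "q \<in> \<Gamma>" "dist q p < d" using assms(2) d(1) closure_approachable by blast
  have "y + p - q \<in> ball y d" using q(2) by (simp add: dist_norm)
  with d(2) have "y + p - q \<in> \<Gamma>" by blast
  from \<Gamma>_add[OF this q(1)] show ?thesis by simp
qed

lemma closure_\<Gamma>_I:
  assumes "\<And>s. s > 0 \<Longrightarrow> x + s *\<^sub>R y \<in> closure \<Gamma>"
  shows "x \<in> closure \<Gamma>"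
proof -
  have "closed {s. x + s *\<^sub>R y \<in> closure \<Gamma>}"
    using continuous_closed_vimage[of "closure \<Gamma>" "\<lambda>s. x + s *\<^sub>R y"] by (simp add: vimage_def)
  moreover have "{0<..} \<subseteq> {s. x + s *\<^sub>R y \<in> closure \<Gamma>}"
    using assms by auto
  ultimately have "closure {0<..} \<subseteq> {s. x + s *\<^sub>R y \<in> closure \<Gamma>}" by (intro closure_minimal)
  moreover have "(0 :: real) \<in> closure {0<..}" by simp
  ultimately have "0 \<in> {s. x + s *\<^sub>R y \<in> closure \<Gamma>}" by blast
  then show ?thesis by simp
qed

lemma closure_\<Gamma>_add:
  assumes "p \<in> closure \<Gamma>" "q \<in> closure \<Gamma>"
  shows "p + q \<in> closure \<Gamma>"
proof (rule closure_\<Gamma>_I[where y = e])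
  fix s :: real assume "s > 0"
  from \<Gamma>_add_closure[OF \<Gamma>_add_closure[OF \<Gamma>_scale[OF e_in_\<Gamma> this] assms(1)] assms(2)]
  show "p + q + s *\<^sub>R e \<in> closure \<Gamma>" using closure_subset by (auto simp: ac_simps)
qed

lemma closure_\<Gamma>_scale:
  assumes p: "p \<in> closure \<Gamma>" and t: "t \<ge> 0"
  shows "t *\<^sub>R p \<in> closure \<Gamma>"
proof (rule closure_\<Gamma>_I[where y = e])
  fix s :: real assume s: "s > 0"
  have "t *\<^sub>R p + s *\<^sub>R e \<in> \<Gamma>"
  proof (cases "t = 0")
    case False
    then have "(s / t) *\<^sub>R e + p \<in> \<Gamma>" using s t by (intro \<Gamma>_add_closure \<Gamma>_scale e_in_\<Gamma> p) auto
    from \<Gamma>_scale[OF this, of t] show ?thesis using False t by (simp add: scaleR_add_right add.commute)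
  qed (use \<Gamma>_scale[OF e_in_\<Gamma> s] in simp)
  then show "t *\<^sub>R p + s *\<^sub>R e \<in> closure \<Gamma>" using closure_subset by blast
qed

section \<open>Monotonicity along the closed cone\<close>

text \<open>
  The roots of \<open>s \<mapsto> g (P + s A)\<close> are real because \<open>A\<close> is hyperbolic, and not positive because
  \<open>P + s A \<in> \<Gamma>\<close> for \<open>s > 0\<close>. Reversing this polynomial gives the factorization of \<open>t \<mapsto> g (A + t P)\<close>.
\<close>

lemma ray_factorization:
  assumes A: "A \<in> \<Gamma>" and P: "P \<in> closure \<Gamma>"
  shows "\<exists>M. (\<forall>\<mu>\<in>#M. \<mu> \<ge> 0) \<and> (\<forall>t. g (A + t *\<^sub>R P) = g A * (\<Prod>\<mu>\<in>#M. 1 + t * \<mu>))"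
proof -
  obtain R where R: "size R = N"
      "\<And>z. G ((P, 0) + cscale z (A, 0)) = of_real (g A) * (\<Prod>r\<in>#R. z - r)"
    using line_factorization[OF \<Gamma>_nonzero[OF A]] by metis
  have roots: "r = of_real (Re r) \<and> Re r \<le> 0" if "r \<in># R" for r
  proof -
    have root: "G ((P, 0) + cscale r (A, 0)) = 0" using that by (auto simp: R(2) image_iff)
    then have "Im r = 0" by (rule hyperbolic_roots_real[OF \<Gamma>_hyperbolic[OF A]])
    then have r: "r = of_real (Re r)" by (simp add: complex_eq_iff)
    have "Re r *\<^sub>R A + P \<in> \<Gamma>" if "Re r > 0" using that by (intro \<Gamma>_add_closure \<Gamma>_scale A P)
    moreover have "g (Re r *\<^sub>R A + P) = 0"
      using root by (subst (asm) r) (simp add: G_real add.commute)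
    ultimately show ?thesis using r \<Gamma>_nonzero by force
  qed
  define M where "M = image_mset (\<lambda>r. - Re r) R"
  have "g (A + t *\<^sub>R P) = g A * (\<Prod>\<mu>\<in>#M. 1 + t * \<mu>)" for t
  proof (cases "t = 0")
    case False
    have "complex_of_real (g (P + (1 / t) *\<^sub>R A)) = of_real (g A) * (\<Prod>r\<in>#R. of_real (1 / t) - r)"
      using R(2)[of "of_real (1 / t)"] by (simp add: G_real del: of_real_divide)
    also have "(\<Prod>r\<in>#R. complex_of_real (1 / t) - r) = (\<Prod>r\<in>#R. of_real (1 / t - Re r))"
      by (intro arg_cong[of _ _ prod_mset] image_mset_cong) (metis roots of_real_diff)
    also have "\<dots> = of_real (\<Prod>r\<in>#R. 1 / t - Re r)" by (rule prod_mset_of_real)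
    finally have "g (P + (1 / t) *\<^sub>R A) = g A * (\<Prod>r\<in>#R. 1 / t - Re r)"
      by (simp flip: of_real_mult del: of_real_divide)
    moreover have "t ^ size R * (\<Prod>r\<in>#R. 1 / t - Re r) = (\<Prod>\<mu>\<in>#M. 1 + t * \<mu>)"
      unfolding M_def using False by (induction R) (auto simp: field_simps)
    moreover have "A + t *\<^sub>R P = t *\<^sub>R (P + (1 / t) *\<^sub>R A)"
      using False by (simp add: scaleR_add_right)
    ultimately show ?thesis using R(1) by (simp add: homogeneous mult.left_commute)
  qed simp
  moreover have "\<forall>\<mu>\<in>#M. \<mu> \<ge> 0" using roots by (auto simp: M_def)
  ultimately show ?thesis by blast
qed

text \<open>
  The derivative is \<open>g A\<close> times the sum of the nonnegative numbers \<open>\<mu>\<close> of the factorization, so it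
  vanishes only if all of them do, and then \<open>g\<close> is constant on the whole line.
\<close>

lemma derivative_closure_\<Gamma>:
  assumes A: "A \<in> \<Gamma>" and P: "P \<in> closure \<Gamma>"
    and D: "((\<lambda>t. g (A + t *\<^sub>R P)) has_real_derivative D) (at 0)"
  shows "D \<ge> 0" and "D = 0 \<Longrightarrow> g (A + t *\<^sub>R P) = g A"
proof -
  obtain M where M: "\<And>\<mu>. \<mu> \<in># M \<Longrightarrow> \<mu> \<ge> 0"
      "\<And>t. g (A + t *\<^sub>R P) = g A * (\<Prod>\<mu>\<in>#M. 1 + t * \<mu>)"
    using ray_factorization[OF A P] by metis
  have "((\<lambda>t. g (A + t *\<^sub>R P)) has_real_derivative g A * sum_mset M) (at 0)"
    unfolding M(2) by (intro DERIV_cmult prod_mset_linear_has_derivative)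
  with D have D: "D = g A * sum_mset M" by (rule DERIV_unique)
  then show "D \<ge> 0" using sum_mset_nonneg_eq_0(1)[OF M(1)] \<Gamma>_positive[OF A] by simp
  assume "D = 0"
  then have "sum_mset M = 0" using D \<Gamma>_positive[OF A] by simp
  then have "\<mu> = 0" if "\<mu> \<in># M" for \<mu> using sum_mset_nonneg_eq_0(2)[OF M(1)] that by blast
  then have "image_mset (\<lambda>\<mu>. 1 + t * \<mu>) M = image_mset (\<lambda>\<mu>. 1) M"
    by (intro image_mset_cong) auto
  then show "g (A + t *\<^sub>R P) = g A" by (simp add: M(2))
qed

lemma constant_line_in_edge:
  assumes A: "A \<in> \<Gamma>" and const: "\<And>t. g (A + t *\<^sub>R P) = g A"
  shows "- P \<in> closure \<Gamma>"
proof -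
  have "range (\<lambda>t. A + t *\<^sub>R P) \<subseteq> \<Gamma>"
  proof (rule \<Gamma>_maximal)
    show "connected (range (\<lambda>t. A + t *\<^sub>R P))"
      by (intro connected_continuous_image continuous_intros connected_UNIV)
    show "A \<in> range (\<lambda>t. A + t *\<^sub>R P)" by (rule image_eqI[of _ _ 0]) auto
  qed (use const \<Gamma>_nonzero[OF A] A in auto)
  then have line: "A + t *\<^sub>R P \<in> \<Gamma>" for t by blast
  \<comment> \<open>Rescaling the line through \<open>A\<close> brings \<open>- P\<close> into the closure.\<close>
  have "- P + s *\<^sub>R A \<in> closure \<Gamma>" if "s > 0" for s
    using \<Gamma>_scale[OF line[of "- 1 / s"] that] that closure_subset[of \<Gamma>]
    by (auto simp: scaleR_diff_right)
  then show ?thesis by (rule closure_\<Gamma>_I)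
qed

text \<open>
  The directions \<open>P\<close> with \<open>\<plusminus>P \<in> closure \<Gamma>\<close> form the edge of the cone, and \<open>g\<close> does not depend on them.
  For \<open>B \<in> \<Gamma>\<close> a number \<open>\<mu> > 0\<close> in the factorization would give a zero of \<open>g\<close> at \<open>B - P / \<mu> \<in> \<Gamma>\<close>. Any other
  \<open>B\<close> enters \<open>\<Gamma>\<close> after adding a large multiple of \<open>e\<close>, and the identity is one between polynomials.
\<close>

lemma edge_invariant:
  assumes P: "P \<in> closure \<Gamma>" "- P \<in> closure \<Gamma>"
  shows "g (B + P) = g B"
proof -
  have cone: "g (B + P) = g B" if B: "B \<in> \<Gamma>" for B
  proof -
    obtain M where M: "\<And>\<mu>. \<mu> \<in># M \<Longrightarrow> \<mu> \<ge> 0"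
        "\<And>t. g (B + t *\<^sub>R P) = g B * (\<Prod>\<mu>\<in>#M. 1 + t * \<mu>)"
      using ray_factorization[OF B P(1)] by metis
    have "\<mu> = 0" if mu: "\<mu> \<in># M" for \<mu>
    proof (rule ccontr)
      assume "\<mu> \<noteq> 0"
      have "B + (1 / \<mu>) *\<^sub>R (- P) \<in> \<Gamma>"
        using M(1)[OF mu] by (intro \<Gamma>_add_closure B closure_\<Gamma>_scale P) auto
      moreover have "g (B + (- 1 / \<mu>) *\<^sub>R P) = 0"
        unfolding M(2) using mu \<open>\<mu> \<noteq> 0\<close> by (auto simp: image_iff intro!: bexI[of _ \<mu>])
      ultimately show False using \<Gamma>_nonzero by fastforce
    qed
    then have "image_mset (\<lambda>\<mu>. 1 + 1 * \<mu>) M = image_mset (\<lambda>\<mu>. 1) M"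
      by (intro image_mset_cong) auto
    then show ?thesis using M(2)[of 1] by simp
  qed
  obtain d where d: "d > 0" "ball e d \<subseteq> \<Gamma>" using open_\<Gamma> e_in_\<Gamma> open_contains_ball by blast
  obtain p where p: "\<And>z. poly p z = G ((B + P, 0) + cscale z (e, 0))" using G_line by metis
  obtain q where q: "\<And>z. poly q z = G ((B, 0) + cscale z (e, 0))" using G_line by metis
  have "p = q"
  proof (rule complex_poly_eqI_reals[of "norm B / d"])
    fix s assume s: "norm B / d < s"
    have "norm B / d \<ge> 0" using d(1) by simp
    with s have s0: "s > 0" by linarith
    have "e + (1 / s) *\<^sub>R B \<in> ball e d" using s s0 d(1) by (simp add: dist_norm field_simps)
    with d(2) have "e + (1 / s) *\<^sub>R B \<in> \<Gamma>" by blast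
    from \<Gamma>_scale[OF this s0] have "B + s *\<^sub>R e \<in> \<Gamma>" using s0 by (simp add: scaleR_add_right add.commute)
    from cone[OF this] show "poly p (of_real s) = poly q (of_real s)"
      by (simp add: p q G_real algebra_simps)
  qed
  then show ?thesis using p[of 0] q[of 0] by (simp add: G_real)
qed

end

section \<open>Symmetric matrices and rank-one forms\<close>

text \<open>
  The Riesz representative of the derivative; its continuity is what makes the averaged gradient
  below continuous.
\<close>

lemma polynomial_gradient:
  fixes p :: "'a :: euclidean_space \<Rightarrow> real"
  assumes "real_polynomial_function p"
  shows "\<exists>D. continuous_on UNIV D \<and> (\<forall>x. (p has_derivative (\<lambda>h. D x \<bullet> h)) (at x))"
  using assms
proof induction
  case (linear f)
  then have lin: "linear f" by (rule bounded_linear.linear)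
  have riesz: "f = (\<lambda>h. adjoint f 1 \<bullet> h)"
    using adjoint_works[OF lin, of _ 1] by (auto simp: inner_commute)
  have "(f has_derivative (\<lambda>h. adjoint f 1 \<bullet> h)) (at x)" for x
    unfolding riesz[symmetric] by (rule bounded_linear_imp_has_derivative[OF linear])
  then show ?case by (intro exI[of _ "\<lambda>_. adjoint f 1"]) auto
next
  case (const c)
  show ?case by (intro exI[of _ "\<lambda>_. 0"]) auto
next
  case (add f g)
  then obtain D E where "continuous_on UNIV D" "\<And>x. (f has_derivative (\<lambda>h. D x \<bullet> h)) (at x)"
    "continuous_on UNIV E" "\<And>x. (g has_derivative (\<lambda>h. E x \<bullet> h)) (at x)" by blast
  then show ?case
    by (intro exI[of _ "\<lambda>x. D x + E x"])
      (auto intro!: continuous_intros derivative_eq_intros simp: inner_add_left)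
next
  case (mult f g)
  then obtain D E where DE: "continuous_on UNIV D" "\<And>x. (f has_derivative (\<lambda>h. D x \<bullet> h)) (at x)"
    "continuous_on UNIV E" "\<And>x. (g has_derivative (\<lambda>h. E x \<bullet> h)) (at x)" by blast
  have "continuous_on UNIV f" "continuous_on UNIV g"
    using DE(2,4) by (meson continuous_at_imp_continuous_on has_derivative_continuous)+
  then show ?case using DE
    by (intro exI[of _ "\<lambda>x. f x *\<^sub>R E x + g x *\<^sub>R D x"])
      (auto intro!: continuous_intros derivative_eq_intros simp: inner_add_left)
qed

definition outer :: "real ^ 'n \<Rightarrow> real ^ 'n \<Rightarrow> real ^ 'n ^ 'n" where
  "outer x y = (\<chi> i j. x $ i * y $ j)"

lemma outer_mult_vec: "outer x y *v z = (y \<bullet> z) *\<^sub>R x"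
  by (simp add: outer_def vec_eq_iff matrix_vector_mult_def inner_vec_def sum_distrib_left
      sum_distrib_right mult_ac)

lemma transpose_outer: "transpose (outer x y) = outer y x"
  by (simp add: outer_def transpose_def vec_eq_iff mult.commute)

lemma outer_add: "outer (x + y) (x + y) = outer x x + outer y y + (outer x y + outer y x)"
  by (simp add: outer_def vec_eq_iff algebra_simps)

lemma outer_scaleR: "outer (c *\<^sub>R x) y = c *\<^sub>R outer x y" "outer x (c *\<^sub>R y) = c *\<^sub>R outer x y"
  by (simp_all add: outer_def vec_eq_iff)

lemma quadratic_form_eq_inner: "x \<bullet> (A *v x) = A \<bullet> outer x x"
  by (simp add: outer_def inner_vec_def matrix_vector_mult_def sum_distrib_left mult_ac)

lemma trace_mult_eq_inner:
  fixes A B :: "real ^ 'n ^ 'n"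
  assumes "transpose B = B"
  shows "trace (A ** B) = A \<bullet> B"
proof -
  have "B $ j $ i = B $ i $ j" for i j
    using assms by (auto simp: transpose_def vec_eq_iff)
  then show ?thesis by (simp add: trace_def matrix_matrix_mult_def inner_vec_def)
qed

lemma linear_transpose: "linear (transpose :: real ^ 'n ^ 'm \<Rightarrow> real ^ 'm ^ 'n)"
  by (auto intro!: linearI simp: transpose_def vec_eq_iff)

lemma transpose_add: "transpose (A + B) = transpose A + (transpose B :: real ^ 'n ^ 'm)"
  and transpose_scaleR: "transpose (c *\<^sub>R A) = c *\<^sub>R (transpose A :: real ^ 'n ^ 'm)"
  and transpose_diff: "transpose (A - B) = transpose A - (transpose B :: real ^ 'n ^ 'm)"
  using linear_add[OF linear_transpose] linear_scale[OF linear_transpose]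
    linear_diff[OF linear_transpose] by blast+

text \<open>
  Composing with the symmetric part extends a function from symmetric matrices to all of them, so
  that the theory of hyperbolic polynomials applies on a whole Euclidean space.
\<close>

definition sym_part :: "real ^ 'n ^ 'n \<Rightarrow> real ^ 'n ^ 'n" where
  "sym_part A = (1 / 2) *\<^sub>R (A + transpose A)"

lemma linear_sym_part: "linear sym_part"
  by (auto intro!: linearI simp: sym_part_def transpose_add transpose_scaleR algebra_simps)

lemma transpose_sym_part: "transpose (sym_part A) = sym_part A"
  by (simp add: sym_part_def transpose_add transpose_scaleR add.commute)

lemma sym_part_in_Sym2: "sym_part A \<in> Sym2 UNIV"
  by (simp add: Sym2_UNIV transpose_sym_part)

lemma sym_part_id: "transpose A = A \<Longrightarrow> sym_part A = A"
  by (simp add: sym_part_def scaleR_2[symmetric])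

lemma inner_transpose: "transpose A \<bullet> B = A \<bullet> transpose (B :: real ^ 'n ^ 'm)"
  unfolding inner_vec_def transpose_def by (simp, subst sum.swap, simp)

lemma sym_part_inner: "transpose B = B \<Longrightarrow> sym_part A \<bullet> B = A \<bullet> B"
  by (simp add: sym_part_def inner_add_left inner_transpose)

lemma subspace_Sym2:
  assumes "subspace V"
  shows "subspace (Sym2 V)"
proof (rule subspaceI)
  show "0 \<in> Sym2 V"
    using subspace_0[OF assms] linear_0[OF linear_transpose] by (auto simp: Sym2_def)
  show "A + B \<in> Sym2 V" if "A \<in> Sym2 V" "B \<in> Sym2 V" for A B
    using that by (auto simp: Sym2_def transpose_add matrix_vector_mult_add_rdistrib
        image_subset_iff intro: subspace_add[OF assms])
  show "c *\<^sub>R A \<in> Sym2 V" if "A \<in> Sym2 V" for c A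
    using that by (auto simp: Sym2_def transpose_scaleR scaleR_matrix_vector_assoc[symmetric]
        image_subset_iff intro: subspace_scale[OF assms])
qed

lemma linear_restrict_form:
  assumes V: "subspace V"
  shows "linear (restrict_form V)"
proof (rule linearI)
  note S = subspace_Sym2[OF V] and r = restrict_form[OF V]
  show "restrict_form V (A + B) = restrict_form V A + restrict_form V B" for A B
    by (rule Sym2_form_inject[OF V])
      (auto simp: r matrix_vector_mult_add_rdistrib inner_add_right intro: subspace_add[OF S] r)
  show "restrict_form V (c *\<^sub>R A) = c *\<^sub>R restrict_form V A" for c A
    by (rule Sym2_form_inject[OF V])
      (auto simp: r scaleR_matrix_vector_assoc[symmetric] intro: subspace_scale[OF S] r)
qed

section \<open>The Hessian of a difference\<close>

lemma grad_diff:
  assumes "u differentiable (at x)" "v differentiable (at x)"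
  shows "grad (\<lambda>y. u y - v y) x = grad u x - grad v x"
proof -
  have "frechet_derivative (\<lambda>y. u y - v y) (at x)
      = (\<lambda>h. frechet_derivative u (at x) h - frechet_derivative v (at x) h)"
    using assms by (intro frechet_derivative_at[symmetric] has_derivative_diff)
      (simp_all add: frechet_derivative_works)
  then show ?thesis by (simp add: grad_def vec_eq_iff)
qed

lemma hessian_diff:
  assumes X: "open X" "x \<in> X" and u: "C2_on X u" and v: "C2_on X v"
  shows "hessian (\<lambda>y. u y - v y) x = hessian u x - hessian v x"
proof -
  let ?D = "\<lambda>h. frechet_derivative (grad u) (at x) h - frechet_derivative (grad v) (at x) h"
  have "((\<lambda>y. grad u y - grad v y) has_derivative ?D) (at x)"
    using u v X(2) by (intro has_derivative_diff)
      (auto simp: C2_on_def frechet_derivative_works[symmetric])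
  then have "(grad (\<lambda>y. u y - v y) has_derivative ?D) (at x)"
    by (rule has_derivative_transform_within_open[OF _ X])
      (use u v in \<open>simp add: C2_on_def grad_diff\<close>)
  then have "frechet_derivative (grad (\<lambda>y. u y - v y)) (at x) = ?D"
    by (rule frechet_derivative_at[symmetric])
  then show ?thesis by (simp add: hessian_def jacobian_def matrix_def vec_eq_iff)
qed

section \<open>Garding-Dirichlet operators\<close>

locale garding_operator =
  fixes g :: "real ^ 'n ^ 'n \<Rightarrow> real" and N :: nat
  assumes garding: "garding_dirichlet UNIV N g"

begin

lemmas garding_unfolded = garding[unfolded garding_dirichlet_def id_form_UNIV]

lemma degree_pos: "N \<ge> 1"
  and g_polynomial: "\<exists>p. real_polynomial_function p \<and> (\<forall>A\<in>Sym2 UNIV. g A = p A)"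
  and g_homogeneous: "\<forall>A\<in>Sym2 UNIV. \<forall>t. g (t *\<^sub>R A) = t ^ N * g A"
  and g_mat_1: "g (mat 1) > 0"
  and g_real_rooted: "\<forall>A\<in>Sym2 UNIV. \<exists>q :: real poly. (\<forall>t. poly q t = g (t *\<^sub>R mat 1 + A)) \<and>
        (\<forall>z :: complex. poly (map_poly complex_of_real q) z = 0 \<longrightarrow> z \<in> \<real>)"
  and psd_in_closure: "{A \<in> Sym2 UNIV. \<forall>x\<in>UNIV. x \<bullet> (A *v x) \<ge> 0} \<subseteq> closure (garding_cone UNIV g)"
  by (fact garding_unfolded[THEN conjunct1]
      garding_unfolded[THEN conjunct2, THEN conjunct1]
      garding_unfolded[THEN conjunct2, THEN conjunct2, THEN conjunct1]
      garding_unfolded[THEN conjunct2, THEN conjunct2, THEN conjunct2, THEN conjunct1]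
      garding_unfolded[THEN conjunct2, THEN conjunct2, THEN conjunct2, THEN conjunct2, THEN conjunct1]
      garding_unfolded[THEN conjunct2, THEN conjunct2, THEN conjunct2, THEN conjunct2, THEN conjunct2])+

end

sublocale garding_operator \<subseteq> hyperbolic_polynomial "\<lambda>A. g (sym_part A)" N "mat 1"
proof
  obtain p where p: "real_polynomial_function p" "\<And>A. A \<in> Sym2 UNIV \<Longrightarrow> g A = p A"
    using g_polynomial by blast
  have "polynomial_function sym_part"
    by (intro polynomial_function_bounded_linear linear_conv_bounded_linear[THEN iffD1] linear_sym_part)
  from real_polynomial_function_compose[OF this p(1)]
  show "real_polynomial_function (\<lambda>A. g (sym_part A))"
    using p(2)[OF sym_part_in_Sym2] by (simp add: o_def)
  show "g (sym_part (t *\<^sub>R A)) = t ^ N * g (sym_part A)" for t A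
    using bspec[OF g_homogeneous sym_part_in_Sym2[of A]]
    by (simp add: linear_scale[OF linear_sym_part])
  have I: "sym_part (mat 1) = (mat 1 :: real ^ 'n ^ 'n)" by (rule sym_part_id) simp
  then show "g (sym_part (mat 1)) > 0" using g_mat_1 by simp
  show "\<exists>q :: real poly. (\<forall>t. poly q t = g (sym_part (t *\<^sub>R mat 1 + A))) \<and>
      (\<forall>z :: complex. poly (map_poly complex_of_real q) z = 0 \<longrightarrow> z \<in> \<real>)" for A
    using bspec[OF g_real_rooted sym_part_in_Sym2[of A]]
    by (simp add: linear_add[OF linear_sym_part] linear_scale[OF linear_sym_part] I)
qed

context garding_operator
begin

lemma garding_cone_subset: "garding_cone UNIV g \<subseteq> \<Gamma>"
  unfolding garding_cone_def \<Gamma>_def id_form_UNIV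
  by (rule connected_component_mono) (auto simp: Sym2_UNIV sym_part_id)

lemma outer_in_closure: "outer x x \<in> closure \<Gamma>"
proof -
  have "outer x x \<in> {A \<in> Sym2 UNIV. \<forall>z\<in>UNIV. z \<bullet> (A *v z) \<ge> 0}"
    by (auto simp: Sym2_UNIV transpose_outer outer_mult_vec inner_commute)
  also have "\<dots> \<subseteq> closure (garding_cone UNIV g)"
    by (rule psd_in_closure)
  also have "\<dots> \<subseteq> closure \<Gamma>" by (intro closure_mono garding_cone_subset)
  finally show ?thesis .
qed

text \<open>
  Discarding \<open>x x\<^sup>T\<close> from the positive semidefinite form \<open>(y + x / s) (y + x / s)\<^sup>T\<close> stays in the closed cone when
  \<open>- x x\<^sup>T\<close> belongs to it. What remains is \<open>y y\<^sup>T + (x y\<^sup>T + y x\<^sup>T) / s\<close>, in which the cross term dominates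
  as \<open>s\<close> tends to \<open>0\<close>.
\<close>

lemma cross_term_in_closure:
  assumes x: "- outer x x \<in> closure \<Gamma>"
  shows "outer x y + outer y x \<in> closure \<Gamma>"
proof (rule closure_\<Gamma>_I[where y = "outer y y"])
  fix s :: real assume s: "s > 0"
  have "s *\<^sub>R (outer ((1 / s) *\<^sub>R x + y) ((1 / s) *\<^sub>R x + y) + (1 / s)\<^sup>2 *\<^sub>R (- outer x x)) \<in> closure \<Gamma>"
    using s by (intro closure_\<Gamma>_scale closure_\<Gamma>_add outer_in_closure x) auto
  also have "s *\<^sub>R (outer ((1 / s) *\<^sub>R x + y) ((1 / s) *\<^sub>R x + y) + (1 / s)\<^sup>2 *\<^sub>R (- outer x x))
      = outer x y + outer y x + s *\<^sub>R outer y y"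
    using s by (simp add: outer_add outer_scaleR scaleR_add_right power2_eq_square)
  finally show "outer x y + outer y x + s *\<^sub>R outer y y \<in> closure \<Gamma>" .
qed

text \<open>
  For a unit vector \<open>x\<close>, restricting a form to the hyperplane orthogonal to \<open>x\<close> subtracts a matrix
  \<open>x y\<^sup>T + y x\<^sup>T\<close>, which lies in the edge as soon as \<open>x x\<^sup>T\<close> does.
\<close>

lemma restriction_to_hyperplane:
  assumes x: "norm x = 1" "- outer x x \<in> closure \<Gamma>" and A: "A \<in> Sym2 UNIV"
  shows "g (restrict_form {z. x \<bullet> z = 0} A) = g A"
proof -
  let ?V = "{z. x \<bullet> z = 0}"
  define y where "y = A *v x - ((x \<bullet> (A *v x)) / 2) *\<^sub>R x"
  define Z where "Z = outer x y + outer y x"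
  have V: "subspace ?V" by (rule subspace_hyperplane)
  have xx: "x \<bullet> x = 1" using x(1) by (simp add: dot_square_norm)
  have tZ: "transpose Z = Z" by (simp add: Z_def transpose_add transpose_outer add.commute)
  have tA: "transpose A = A" using A by (simp add: Sym2_UNIV)
  have Bz: "(A - Z) *v z = A *v z - (y \<bullet> z) *\<^sub>R x - (x \<bullet> z) *\<^sub>R y" for z
    by (simp add: Z_def matrix_vector_mult_diff_rdistrib matrix_vector_mult_add_rdistrib outer_mult_vec)
  have yz: "y \<bullet> z = (A *v x) \<bullet> z - (x \<bullet> (A *v x)) / 2 * (x \<bullet> z)" for z
    by (simp add: y_def inner_diff_left)
  have xy: "x \<bullet> y = (x \<bullet> (A *v x)) / 2" by (simp add: y_def inner_diff_right xx)
  have "x \<bullet> ((A - Z) *v z) = 0" for z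
    unfolding Bz inner_diff_right inner_scaleR_right xx xy yz
    by (simp add: Sym2_inner[OF A, of x z] mult.commute)
  then have "A - Z \<in> Sym2 ?V" by (auto simp: Sym2_def transpose_diff tA tZ)
  then have B: "restrict_form ?V A = A - Z"
  proof (rule Sym2_form_inject[OF V restrict_form(1)[OF V]])
    fix z assume z: "z \<in> ?V"
    then have "z \<bullet> x = 0" "x \<bullet> z = 0" by (simp_all add: inner_commute)
    then show "z \<bullet> (restrict_form ?V A *v z) = z \<bullet> ((A - Z) *v z)"
      unfolding restrict_form(2)[OF V z] Bz by (simp add: inner_diff_right)
  qed
  have "- Z = outer x (- y) + outer (- y) x" by (simp add: Z_def outer_def vec_eq_iff)
  then have "Z \<in> closure \<Gamma>" "- Z \<in> closure \<Gamma>"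
    unfolding Z_def using cross_term_in_closure[OF x(2)] by metis+
  from edge_invariant[OF this, of "A - Z"] show ?thesis
    by (simp add: B sym_part_id tA tZ transpose_diff)
qed

text \<open>
  Since \<open>g\<close> depends only on the restriction to the hyperplane, it is itself a Garding-Dirichlet
  polynomial there. The condition on the cone is inherited because the restriction map is linear
  and sends the cone of \<open>g\<close> into that of the restricted polynomial.
\<close>

lemma garding_dirichlet_hyperplane:
  assumes x: "norm x = 1" "- outer x x \<in> closure \<Gamma>"
  shows "garding_dirichlet {z. x \<bullet> z = 0} N g"
proof -
  let ?V = "{z. x \<bullet> z = 0}" and ?r = "restrict_form {z. x \<bullet> z = 0}"
  have V: "subspace ?V" by (rule subspace_hyperplane)
  note lin = linear_restrict_form[OF V]
  have sub: "Sym2 ?V \<subseteq> Sym2 UNIV" by (auto simp: Sym2_def)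
  have fixed: "?r A = A" if "A \<in> Sym2 ?V" for A
    by (intro Sym2_form_inject[OF V] restrict_form[OF V] that) auto
  have I: "mat 1 \<in> Sym2 UNIV" by (simp add: Sym2_UNIV)
  have gI: "g (id_form ?V) > 0"
    using restriction_to_hyperplane[OF x I] g_mat_1 by (simp add: id_form_def)
  have line: "g (t *\<^sub>R id_form ?V + A) = g (t *\<^sub>R mat 1 + A)" if "A \<in> Sym2 ?V" for A t
  proof -
    have "?r (t *\<^sub>R mat 1 + A) = t *\<^sub>R id_form ?V + A"
      by (simp add: linear_add[OF lin] linear_scale[OF lin] fixed[OF that] id_form_def)
    moreover have "t *\<^sub>R mat 1 + A \<in> Sym2 UNIV"
      using sub that I by (intro subspace_add subspace_scale subspace_Sym2 subspace_UNIV) auto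
    ultimately show ?thesis using restriction_to_hyperplane[OF x] by metis
  qed
  have cone: "?r ` garding_cone UNIV g \<subseteq> garding_cone ?V g"
    unfolding garding_cone_def[of ?V]
  proof (rule connected_component_maximal)
    have nz: "garding_cone UNIV g \<subseteq> {A \<in> Sym2 UNIV. g A \<noteq> 0}"
      unfolding garding_cone_def by (rule connected_component_subset)
    have "mat 1 \<in> garding_cone UNIV g"
      using g_mat_1 I by (simp add: garding_cone_def id_form_UNIV)
    then show "id_form ?V \<in> ?r ` garding_cone UNIV g" unfolding id_form_def by blast
    show "connected (?r ` garding_cone UNIV g)"
      by (intro connected_continuous_image linear_continuous_on linear_conv_bounded_linear[THEN iffD1] lin)
        (auto simp: garding_cone_def)
    show "?r ` garding_cone UNIV g \<subseteq> {A \<in> Sym2 ?V. g A \<noteq> 0}"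
      using nz restriction_to_hyperplane[OF x] restrict_form(1)[OF V] by fastforce
  qed
  have psd: "A \<in> closure (garding_cone ?V g)"
    if A: "A \<in> Sym2 ?V" and pos: "\<And>z. z \<in> ?V \<Longrightarrow> z \<bullet> (A *v z) \<ge> 0" for A
  proof -
    \<comment> \<open>A form on the hyperplane, extended by zero, takes at \<open>z\<close> its value at the projection of \<open>z\<close>.\<close>
    have "z \<bullet> (A *v z) \<ge> 0" for z
    proof -
      define w where "w = z - (x \<bullet> z) *\<^sub>R x"
      have w: "w \<in> ?V" using x(1) by (simp add: w_def inner_diff_right dot_square_norm)
      have "A *v x = 0"
      proof -
        have "A *v (A *v x) \<in> ?V" using A by (auto simp: Sym2_def)
        then have "(A *v x) \<bullet> (A *v x) = 0"
          using Sym2_inner[OF A, of x "A *v x"] by simp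
        then show ?thesis by simp
      qed
      moreover have "x \<bullet> (A *v z) = 0" using A by (auto simp: Sym2_def)
      ultimately have "z \<bullet> (A *v z) = w \<bullet> (A *v w)"
        by (simp add: w_def matrix_vector_mult_diff_distrib matrix_vector_mult_scaleR inner_diff_left)
      then show ?thesis using pos[OF w] by simp
    qed
    then have "A \<in> closure (garding_cone UNIV g)" using psd_in_closure sub A by blast
    then have "?r A \<in> ?r ` closure (garding_cone UNIV g)" by blast
    also have "\<dots> \<subseteq> closure (?r ` garding_cone UNIV g)"
      by (rule closure_linear_image_subset[OF lin])
    also have "\<dots> \<subseteq> closure (garding_cone ?V g)" by (rule closure_mono[OF cone])
    finally show ?thesis by (simp add: fixed[OF A])
  qed
  show ?thesis
    unfolding garding_dirichlet_def
  proof (intro conjI)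
    show "\<forall>A\<in>Sym2 ?V. \<exists>q :: real poly. (\<forall>t. poly q t = g (t *\<^sub>R id_form ?V + A)) \<and>
        (\<forall>z :: complex. poly (map_poly complex_of_real q) z = 0 \<longrightarrow> z \<in> \<real>)"
    proof
      fix A assume A: "A \<in> Sym2 ?V"
      with sub have "A \<in> Sym2 UNIV" by blast
      from bspec[OF g_real_rooted this]
      show "\<exists>q :: real poly. (\<forall>t. poly q t = g (t *\<^sub>R id_form ?V + A)) \<and>
          (\<forall>z :: complex. poly (map_poly complex_of_real q) z = 0 \<longrightarrow> z \<in> \<real>)"
        unfolding line[OF A] .
    qed
    show "{A \<in> Sym2 ?V. \<forall>z\<in>?V. z \<bullet> (A *v z) \<ge> 0} \<subseteq> closure (garding_cone ?V g)"
      using psd by blast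
    show "\<exists>p. real_polynomial_function p \<and> (\<forall>A\<in>Sym2 ?V. g A = p A)"
      using g_polynomial sub by blast
    show "\<forall>A\<in>Sym2 ?V. \<forall>t. g (t *\<^sub>R A) = t ^ N * g A" using g_homogeneous sub by blast
  qed (fact degree_pos gI)+
qed

lemma complete_imp_rank_one_not_in_edge:
  assumes "garding_complete g" "x \<noteq> 0"
  shows "- outer x x \<notin> closure \<Gamma>"
proof
  assume edge: "- outer x x \<in> closure \<Gamma>"
  define w where "w = (1 / norm x) *\<^sub>R x"
  have w: "norm w = 1" using assms(2) by (simp add: w_def)
  have "- outer w w = (1 / norm x)\<^sup>2 *\<^sub>R (- outer x x)"
    by (simp add: w_def outer_scaleR power2_eq_square)
  then have e: "- outer w w \<in> closure \<Gamma>" using closure_\<Gamma>_scale[OF edge] by simp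
  have "w \<notin> {z. w \<bullet> z = 0}" using w by (auto simp: dot_square_norm)
  then have "{z. w \<bullet> z = 0} \<noteq> UNIV" by blast
  then show False
    using assms(1) subspace_hyperplane[of w] garding_dirichlet_hyperplane[OF w e]
      restriction_to_hyperplane[OF w e] unfolding garding_complete_def by metis
qed

text \<open>
  This is where completeness enters: a vanishing derivative in the direction \<open>x x\<^sup>T\<close> would put that
  direction into the edge, and \<open>g\<close> would live on a hyperplane.
\<close>

lemma gradient_rank_one_positive:
  assumes "garding_complete g" "A \<in> \<Gamma>" "x \<noteq> 0"
    and D: "((\<lambda>A. g (sym_part A)) has_derivative (\<lambda>h. D \<bullet> h)) (at A)"
  shows "D \<bullet> outer x x > 0"
proof -
  have "((\<lambda>t. g (sym_part (A + t *\<^sub>R outer x x))) has_derivative (\<lambda>t. D \<bullet> (t *\<^sub>R outer x x))) (at 0)"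
    by (rule has_derivative_compose[where f = "\<lambda>t. A + t *\<^sub>R outer x x"])
      (auto intro!: derivative_eq_intros simp: D)
  then have d: "((\<lambda>t. g (sym_part (A + t *\<^sub>R outer x x))) has_real_derivative D \<bullet> outer x x) (at 0)"
    unfolding has_field_derivative_def by (simp add: mult.commute[of _ "D \<bullet> outer x x"] mult_commute_abs)
  note der = derivative_closure_\<Gamma>[OF assms(2) outer_in_closure d]
  have "D \<bullet> outer x x \<noteq> 0"
    using constant_line_in_edge[OF assms(2) der(2)]
      complete_imp_rank_one_not_in_edge[OF assms(1,3)] by blast
  with der(1) show ?thesis by simp
qed

text \<open>
  \<open>K (A, B)\<close> is the symmetric part of \<open>\<integral> \<nabla>g (B + t (A - B)) dt\<close> over the unit interval. By convexity the segment
  stays in the cone, so the integrand is positive on each \<open>x x\<^sup>T\<close>, and so is the average.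
\<close>

lemma averaged_gradient:
  assumes complete: "garding_complete g"
  shows "\<exists>K :: (real ^ 'n ^ 'n) \<times> (real ^ 'n ^ 'n) \<Rightarrow> real ^ 'n ^ 'n. continuous_on UNIV K \<and>
    (\<forall>A\<in>\<Gamma>. \<forall>B\<in>\<Gamma>. pos_def_matrix (K (A, B))) \<and>
    (\<forall>A\<in>Sym2 UNIV. \<forall>B\<in>Sym2 UNIV. K (A, B) \<bullet> (A - B) = g A - g B)"
proof -
  obtain D where D: "continuous_on UNIV D"
      "\<And>A. ((\<lambda>A. g (sym_part A)) has_derivative (\<lambda>h. D A \<bullet> h)) (at A)"
    using polynomial_gradient[OF polynomial] by blast
  define \<gamma> where "\<gamma> AB t = snd AB + t *\<^sub>R (fst AB - snd AB)"
    for AB :: "(real ^ 'n ^ 'n) \<times> (real ^ 'n ^ 'n)" and t :: real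
  define J where "J AB = integral (cbox 0 1) (\<lambda>t. D (\<gamma> AB t))" for AB
  have cont_D: "continuous_on S (\<lambda>x. D (f x))" if "continuous_on S f"
    for S and f :: "'b :: topological_space \<Rightarrow> _"
    using continuous_on_compose2[OF D(1) that] by simp
  have cont_t: "continuous_on S (\<lambda>t. D (\<gamma> AB t))" for AB S
    unfolding \<gamma>_def by (intro cont_D continuous_intros)
  have J_inner: "((\<lambda>t. D (\<gamma> AB t) \<bullet> C) has_integral J AB \<bullet> C) {0..1}" for AB C
  proof -
    have "(\<lambda>t. D (\<gamma> AB t)) integrable_on cbox 0 1" by (rule integrable_continuous[OF cont_t])
    then have "((\<lambda>t. D (\<gamma> AB t)) has_integral J AB) (cbox 0 1)"
      unfolding J_def by (rule integrable_integral)
    from has_integral_linear[OF this bounded_linear_inner_left[of C]]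
    show ?thesis by (simp add: o_def)
  qed
  have "continuous_on UNIV J"
    unfolding J_def
    by (rule integral_continuous_on_param)
      (auto simp: \<gamma>_def split_def intro!: cont_D continuous_intros)
  then have cont: "continuous_on UNIV (\<lambda>AB. sym_part (J AB))"
    by (rule linear_continuous_on_compose) (rule linear_sym_part)
  have pos: "pos_def_matrix (sym_part (J (A, B)))" if AB: "A \<in> \<Gamma>" "B \<in> \<Gamma>" for A B
    unfolding pos_def_matrix_def
  proof (intro conjI allI impI transpose_sym_part)
    fix x :: "real ^ 'n" assume x: "x \<noteq> 0"
    have seg: "D (\<gamma> (A, B) t) \<bullet> outer x x > 0" if "t \<in> {0..1}" for t
    proof -
      have "(1 - t) *\<^sub>R B + t *\<^sub>R A \<in> \<Gamma>" using that AB by (intro convexD[OF convex_\<Gamma>]) auto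
      then have "\<gamma> (A, B) t \<in> \<Gamma>" by (simp add: \<gamma>_def algebra_simps)
      from gradient_rank_one_positive[OF complete this x D(2)] show ?thesis .
    qed
    have ge: "J (A, B) \<bullet> outer x x \<ge> 0"
      using has_integral_nonneg[OF J_inner] seg by (meson less_imp_le)
    have "J (A, B) \<bullet> outer x x \<noteq> 0"
    proof
      assume "J (A, B) \<bullet> outer x x = 0"
      with J_inner[of "(A, B)" "outer x x"]
      have zero: "((\<lambda>t. D (\<gamma> (A, B) t) \<bullet> outer x x) has_integral 0) (cbox 0 1)" by simp
      have "D (\<gamma> (A, B) 0) \<bullet> outer x x = 0"
        by (rule has_integral_0_cbox_imp_0[OF _ _ zero])
          (use seg in \<open>auto intro!: continuous_intros cont_t less_imp_le\<close>)
      then show False using seg[of 0] by simp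
    qed
    with ge show "x \<bullet> (sym_part (J (A, B)) *v x) > 0"
      by (simp add: quadratic_form_eq_inner sym_part_inner transpose_outer)
  qed
  have diff: "sym_part (J (A, B)) \<bullet> (A - B) = g A - g B" if "A \<in> Sym2 UNIV" "B \<in> Sym2 UNIV" for A B
  proof -
    have t: "transpose A = A" "transpose B = B" using that by (simp_all add: Sym2_UNIV)
    have "((\<lambda>t. g (sym_part (\<gamma> (A, B) t))) has_vector_derivative D (\<gamma> (A, B) t) \<bullet> (A - B))
        (at t within {0..1})" for t
    proof -
      have "(\<gamma> (A, B) has_derivative (\<lambda>t. t *\<^sub>R (A - B))) (at t within {0..1})"
        unfolding \<gamma>_def by (auto intro!: derivative_eq_intros)
      from has_derivative_compose[OF this D(2)] show ?thesis
        by (simp add: has_vector_derivative_def)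
    qed
    then have "((\<lambda>t. D (\<gamma> (A, B) t) \<bullet> (A - B)) has_integral
        g (sym_part (\<gamma> (A, B) 1)) - g (sym_part (\<gamma> (A, B) 0))) {0..1}"
      by (intro fundamental_theorem_of_calculus) auto
    then have "J (A, B) \<bullet> (A - B) = g A - g B"
      using has_integral_unique[OF J_inner] by (simp add: \<gamma>_def sym_part_id t)
    then show ?thesis by (simp add: sym_part_inner transpose_diff t)
  qed
  show ?thesis using cont pos diff by (intro exI[of _ "\<lambda>AB. sym_part (J AB)"]) blast
qed

end

section \<open>The linear equation for the difference of two solutions\<close>

theorem theorem4p1:
  fixes g :: "real ^ 'n ^ 'n \<Rightarrow> real" and N :: nat
    and X :: "(real ^ 'n) set" and f u v :: "real ^ 'n \<Rightarrow> real"
  assumes "garding_dirichlet UNIV N g"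
    and "garding_complete g"
    and "open X"
    and "C2_on X u"
    and "\<And>x. x \<in> X \<Longrightarrow> g (hessian u x) = exp (f x) \<and> hessian u x \<in> garding_cone UNIV g"
    and "C2_on X v"
    and "\<And>x. x \<in> X \<Longrightarrow> g (hessian v x) = exp (f x) \<and> hessian v x \<in> garding_cone UNIV g"
  shows "\<exists>M :: real ^ 'n \<Rightarrow> real ^ 'n ^ 'n.
           continuous_on X M \<and>
           (\<forall>x\<in>X. pos_def_matrix (M x)) \<and>
           (\<forall>x\<in>X. trace (M x ** hessian (\<lambda>y. u y - v y) x) = 0)"
proof -
  interpret garding_operator g N by unfold_locales (rule assms(1))
  obtain K :: "(real ^ 'n ^ 'n) \<times> (real ^ 'n ^ 'n) \<Rightarrow> real ^ 'n ^ 'n" where K: "continuous_on UNIV K"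
      "\<And>A B. A \<in> \<Gamma> \<Longrightarrow> B \<in> \<Gamma> \<Longrightarrow> pos_def_matrix (K (A, B))"
      "\<And>A B. A \<in> Sym2 UNIV \<Longrightarrow> B \<in> Sym2 UNIV \<Longrightarrow> K (A, B) \<bullet> (A - B) = g A - g B"
    using averaged_gradient[OF assms(2)] by blast
  have sym: "garding_cone UNIV g \<subseteq> Sym2 UNIV"
    unfolding garding_cone_def using connected_component_subset by blast
  let ?M = "\<lambda>x. K (hessian u x, hessian v x)"
  show ?thesis
  proof (intro exI[of _ ?M] conjI ballI)
    show "continuous_on X ?M"
      using assms(4,6) unfolding C2_on_def
      by (intro continuous_on_compose2[OF K(1)] continuous_on_Pair) auto
  next
    fix x assume x: "x \<in> X"
    then have cone: "hessian u x \<in> garding_cone UNIV g" "hessian v x \<in> garding_cone UNIV g"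
      using assms(5,7) by blast+
    then show "pos_def_matrix (?M x)" using garding_cone_subset by (intro K(2)) auto
    have S: "hessian u x \<in> Sym2 UNIV" "hessian v x \<in> Sym2 UNIV" using cone sym by blast+
    have "trace (?M x ** hessian (\<lambda>y. u y - v y) x) = ?M x \<bullet> (hessian u x - hessian v x)"
      using S unfolding hessian_diff[OF assms(3) x assms(4,6)]
      by (intro trace_mult_eq_inner) (simp add: Sym2_UNIV transpose_diff)
    also have "\<dots> = 0" using K(3)[OF S] assms(5,7) x by simp
    finally show "trace (?M x ** hessian (\<lambda>y. u y - v y) x) = 0" .
  qed
qed

end
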